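(* Suppose that $0\le p=\frac{1}{2n}(\log n+\log\log n+c_n)\le \frac12$ for a real sequence $(c_n)$, and let $G$ be a random subgraph of $K_{n,n}$ (on the same vertex set) obtained by keeping each edge independently with probability $p$. (a) If $c_n\to\infty$ as $n\to\infty$, then with high probability $G$ is reconstructible from the collection of its $1$-balls with unlabelled centres. (b) If $c_n\to-\infty$ as $n\to\infty$, and assuming that $G$ has at least two edges, then with high probability $G$ is not reconstructible from the collection of its $1$-balls with unlabelled centres; that is, with high probability, either $G$ has fewer than two edges or $G$ is not reconstructible in this sense. (c) If $c_n\to c\in\mathbb{R}$ as $n\to\infty$, then the probability that $G$ is reconstructible from the collection of its $1$-balls with unlabelled centres tends to an explicit constant, depending only on $c$, that is strictly between $0$ and $1$.
   Context: Let $\mathcal{I}$ and $\mathcal{J}$ be the two labelled vertex classes of $K_{n,n}$, each of size $n$. The collection of $1$-balls with unlabelled centres of a subgraph $G$ of $K_{n,n}$ (on the vertex set $\mathcal{I}\cup\mathcal{J}$) records, for each vertex $v$, the set $N_G(v)$ of labelled neighbours of $v$, but not the label of $v$ itself; thus it consists of the multiset $[N_G(i):i\in\mathcal{I}]$ of subsets of $\mathcal{J}$ and the multiset $[N_G(j):j\in\mathcal{J}]$ of subsets of $\mathcal{I}$. $G$ is reconstructible from this collection if every subgraph $G'$ of $K_{n,n}$ on vertex set $\mathcal{I}\cup\mathcal{J}$ with the same two multisets has the same edge set as $G$. An event $E=E_n$ happens with high probability if $\mathbb{P}(E_n)\to1$ as $n\to\infty$. Logarithms are natural. *)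

theory Defs
  imports "HOL-Probability.Probability"
begin

text \<open>
  A subgraph of the complete bipartite graph with vertex classes \<open>I\<close> and \<open>J\<close>, on the vertex set
  \<open>I \<union> J\<close> (disjoint union), is given by its edge set \<open>E \<subseteq> I \<times> J\<close>.  The classes are told apart by
  the position in the pair, so \<open>I\<close> and \<open>J\<close> may share elements as sets.
  The neighbourhood of \<open>i \<in> I\<close> is \<open>E `` {i}\<close>, that of \<open>j \<in> J\<close> is \<open>E\<inverse> `` {j}\<close>.
\<close>

definition unlabelled_balls ::
    "'a set \<Rightarrow> 'b set \<Rightarrow> ('a \<times> 'b) set \<Rightarrow> 'b set multiset \<times> 'a set multiset" where
  "unlabelled_balls I J E =
     (image_mset (\<lambda>i. E `` {i}) (mset_set I), image_mset (\<lambda>j. E\<inverse> `` {j}) (mset_set J))"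

definition reconstructible :: "'a set \<Rightarrow> 'b set \<Rightarrow> ('a \<times> 'b) set \<Rightarrow> bool" where
  "reconstructible I J E \<longleftrightarrow>
     (\<forall>E'. E' \<subseteq> I \<times> J \<and> unlabelled_balls I J E' = unlabelled_balls I J E \<longrightarrow> E' = E)"

text \<open>
  The random subgraph keeps each pair in \<open>I \<times> J\<close> independently with probability \<open>p\<close>
  (\<^const>\<open>bernoulli_pmf\<close> truncates its parameter to \<open>[0, 1]\<close>).
\<close>

definition random_subgraph :: "'a set \<Rightarrow> 'b set \<Rightarrow> real \<Rightarrow> ('a \<times> 'b) set pmf" where
  "random_subgraph I J p =
     map_pmf (\<lambda>\<omega>. {e \<in> I \<times> J. \<omega> e}) (Pi_pmf (I \<times> J) False (\<lambda>_. bernoulli_pmf p))"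

abbreviation random_Knn :: "nat \<Rightarrow> real \<Rightarrow> (nat \<times> nat) set pmf" where
  "random_Knn n p \<equiv> random_subgraph {..<n} {..<n} p"

definition whp :: "(nat \<Rightarrow> 'a pmf) \<Rightarrow> (nat \<Rightarrow> 'a \<Rightarrow> bool) \<Rightarrow> bool" where
  "whp M A \<longleftrightarrow> (\<lambda>n. measure_pmf.prob (M n) {x. A n x}) \<longlonglongrightarrow> 1"

text \<open>
  In the critical window the number of isolated edges is asymptotically Poisson with mean
  \<open>\<lambda> = lim n\<^sup>2 p (1 - p)\<^bsup>2n-2\<^esup> = exp (-c) / 2\<close>, and the limiting probability below is that of this
  Poisson variable being at most one: two isolated edges can be re-paired, whereas with at most
  one isolated edge, with high probability, every automorphism fixing both classes
  only permutes vertices with equal neighbourhoods.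
\<close>

definition critical_prob :: "real \<Rightarrow> real" where
  "critical_prob c = (1 + exp (- c) / 2) * exp (- (exp (- c) / 2))"

end

theory Submission
  imports Defs "HOL-Combinatorics.Permutations" "HOL-Real_Asymp.Real_Asymp"
begin

text \<open>
  Write \<open>x = n p\<close>.  If \<open>E\<close> and \<open>E'\<close> have the same unlabelled balls, a permutation \<open>\<sigma>\<close> of the rows turns
  \<open>E\<close> into \<open>E'\<close>, and a permutation \<open>\<rho>\<close> of the columns turns \<open>E'\<close> into \<open>E\<close>; both can be chosen to move only
  rows and columns in which \<open>E\<close> and \<open>E'\<close> differ.  Then \<open>(\<sigma>, \<rho>)\<close> is an automorphism of \<open>E\<close> under which every
  moved vertex has a moved neighbour (\<open>automorphism_of_not_reconstructible\<close>).  Two isolated edges always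
  give such an automorphism, since they can be re-paired.  The main point is the converse: as soon as
  \<open>x \<ge> (log n) / 2\<close>, with high probability a random graph that has at most one isolated edge is
  reconstructible (\<open>prob_not_reconstructible_few_isolated_edges_tendsto\<close>).

  Let \<open>S\<close> be the set of moved vertices and \<open>s\<close> its size.  At most \<open>n\<^sup>s\<close> pairs \<open>(\<sigma>, \<rho>)\<close> move given numbers
  of rows and columns with sum \<open>s\<close>.  The cells that a pair moves fall into orbits of size at least two,
  on which an invariant graph is constant, so that an invariant graph with many edges there is much
  rarer than a graph with that many edges: the probability of being invariant under a given pair and
  having at least \<open>6 s\<close> edges at \<open>S\<close> is at most \<open>(p\<^sup>2 exp (- x / 12))\<^sup>s\<close>, and the union bound over
  \<open>(\<sigma>, \<rho>)\<close> succeeds.  If there are fewer edges at \<open>S\<close>, then most vertices of \<open>S\<close>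
  have bounded degree.  But three vertices of bounded degree are unlikely to be close together: on a tree
  with \<open>f \<in> {2, 3}\<close> edges they occur with expectation at most of the order
  \<open>n\<^bsup>f+1\<^esup> p\<^sup>f exp (- 27 x / 10)\<close>, which tends to \<open>0\<close> because \<open>n \<le> exp (2 x)\<close>.
  A deterministic argument (\<open>card_moved_le_card_high\<close>) shows that in the absence of such trees, and of a second isolated edge, a tenth of \<open>S\<close> has large degree, so that there are \<open>6 s\<close>
  edges at \<open>S\<close> after all.

  It remains to study the number \<open>X\<close> of isolated edges.  Its binomial moments are explicit, as the
  expected number of \<open>k\<close>-matchings all of whose edges are isolated, and \<open>n\<^sup>2 p exp (- 2 x)\<close>, which is
  asymptotic to \<open>E X\<close> if \<open>n p\<^sup>2\<close> tends to \<open>0\<close>, equals \<open>(x / log n) exp (- c)\<close>.  If \<open>c \<rightarrow> \<infinity>\<close>, the mean tends to \<open>0\<close>.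
  If \<open>c \<rightarrow> - \<infinity>\<close>, Chebyshev's inequality gives \<open>X \<ge> 2\<close>, unless \<open>p\<close> is so small that with high probability
  no two edges meet and all edges are isolated.  If \<open>c\<close> converges, the Bonferroni inequalities give the
  Poisson limit of \<open>P (X \<le> 1)\<close>.
\<close>

section \<open>Moved vertices in a graph with few vertices of low degree\<close>

lemma card_le_two_if_no_three:
  assumes "\<And>x y z. x \<in> A \<Longrightarrow> y \<in> A \<Longrightarrow> z \<in> A \<Longrightarrow> x \<noteq> y \<Longrightarrow> y \<noteq> z \<Longrightarrow> x \<noteq> z \<Longrightarrow> False"
  shows "finite A \<and> card A \<le> 2"
proof (rule ccontr)
  assume a: "\<not> (finite A \<and> card A \<le> 2)"
  have "\<exists>B\<subseteq>A. finite B \<and> card B = 3"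
  proof (cases "finite A")
    case True
    then show ?thesis using a obtain_subset_with_card_n[of 3 A] by (metis Suc_leI finite_subset not_le numeral_3_eq_3 numeral_2_eq_2)
  next
    case False
    then show ?thesis using infinite_arbitrarily_large by blast
  qed
  then show False using assms unfolding card_3_iff by auto
qed

text \<open>
  Think of \<open>low\<close> as having bounded degree.  Let \<open>x\<close> be a moved low vertex without a high moved neighbour;
  it has a low moved neighbour \<open>y\<close>.  A further neighbour \<open>z\<close> of \<open>x\<close> is impossible: if \<open>z\<close> is moved it is low,
  and \<open>y x z\<close> is a low path; if \<open>z\<close> is fixed it is also adjacent to \<open>\<theta> x\<close>, and \<open>y\<close>, \<open>x\<close>, \<open>\<theta> x\<close> are low on the
  path \<open>y x z (\<theta> x)\<close>.  The same reasoning applies to \<open>y\<close>, so either \<open>x y\<close> is an isolated edge or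
  \<open>y\<close> has a high moved neighbour.  Hence, apart from the two ends of an isolated edge, every moved low vertex
  is near a high moved vertex, and each high vertex can serve only four low ones.
\<close>

lemma card_moved_le_card_high:
  fixes adj :: "'v \<Rightarrow> 'v \<Rightarrow> bool"
  assumes sym: "\<And>x y. adj x y \<Longrightarrow> adj y x"
    and irr: "\<And>x. \<not> adj x x"
    and aut: "\<And>x y. adj x y \<Longrightarrow> adj (\<theta> x) (\<theta> y)"
    and fin: "finite S" and S4: "card S \<ge> 4"
    and moved: "\<And>x. x \<in> S \<longleftrightarrow> \<theta> x \<noteq> x"
    and nadj: "\<And>x. \<not> adj x (\<theta> x)"
    and low_\<theta>: "\<And>x. low x \<Longrightarrow> low (\<theta> x)"
    and nbr: "\<And>x. x \<in> S \<Longrightarrow> \<exists>y\<in>S. adj x y"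
    and P3: "\<And>x y z. adj x y \<Longrightarrow> adj y z \<Longrightarrow> x \<noteq> z \<Longrightarrow> low x \<Longrightarrow> low y \<Longrightarrow> low z \<Longrightarrow> False"
    and P4: "\<And>x y w z. adj x y \<Longrightarrow> adj y w \<Longrightarrow> adj w z \<Longrightarrow> x \<noteq> w \<Longrightarrow> y \<noteq> z \<Longrightarrow> x \<noteq> z \<Longrightarrow>
              low x \<Longrightarrow> low y \<Longrightarrow> low z \<Longrightarrow> False"
    and St: "\<And>v x y z. adj v x \<Longrightarrow> adj v y \<Longrightarrow> adj v z \<Longrightarrow> x \<noteq> y \<Longrightarrow> y \<noteq> z \<Longrightarrow> x \<noteq> z \<Longrightarrow>
              low x \<Longrightarrow> low y \<Longrightarrow> low z \<Longrightarrow> False"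
    and iso: "finite {x. \<exists>y. adj x y \<and> (\<forall>z. adj x z \<longrightarrow> z = y) \<and> (\<forall>z. adj y z \<longrightarrow> z = x)} \<and>
              card {x. \<exists>y. adj x y \<and> (\<forall>z. adj x z \<longrightarrow> z = y) \<and> (\<forall>z. adj y z \<longrightarrow> z = x)} \<le> 2"
  shows "card S \<le> 10 * card {x \<in> S. \<not> low x}"
proof -
  define H where "H = {x \<in> S. \<not> low x}"
  define Z where "Z = {x. \<exists>y. adj x y \<and> (\<forall>z. adj x z \<longrightarrow> z = y) \<and> (\<forall>z. adj y z \<longrightarrow> z = x)}"
  define N where "N h = {x. low x \<and> adj h x}" for h
  have N2: "finite (N h) \<and> card (N h) \<le> 2" for h
    by (rule card_le_two_if_no_three) (auto simp: N_def intro: St)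
  have Nlow: "finite (N y) \<and> card (N y) \<le> 1" if "low y" for y
  proof -
    have "x = z" if "x \<in> N y" "z \<in> N y" for x z
      using that \<open>low y\<close> P3[of x y z] sym[of y x] by (auto simp: N_def)
    then show ?thesis using N2[of y] card_le_Suc0_iff_eq[of "N y"] by auto
  qed
  have key: "\<exists>h\<in>H. x \<in> N h \<or> (\<exists>y\<in>N h. x \<in> N y)" if x: "x \<in> S" "low x" "x \<notin> Z" for x
  proof (rule ccontr)
    assume neg: "\<not> ?thesis"
    from nbr x obtain y where y: "y \<in> S" "adj x y" by blast
    have ly: "low y" using neg y x sym by (auto simp: H_def N_def)
    \<comment> \<open>An edge from \<open>u\<close> to a fixed vertex \<open>z\<close> also gives the edge from \<open>\<theta> u\<close> to \<open>z\<close>, so that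
        \<open>v\<close>, \<open>u\<close>, \<open>\<theta> u\<close> are three low vertices on a path \<open>v u z (\<theta> u)\<close>.\<close>
    have only: "z = v" if uv: "adj u v" "u \<in> S" "low u" "low v"
      and nh: "\<And>h. h \<in> H \<Longrightarrow> \<not> adj u h" and uz: "adj u z" for u v z
    proof (rule ccontr)
      assume ne: "z \<noteq> v"
      show False
      proof (cases "z \<in> S")
        case True
        then have "low z" using nh uz by (auto simp: H_def)
        then show False using P3[of v u z] sym uv uz ne by blast
      next
        case False
        then have "\<theta> z = z" using moved by blast
        then have "adj z (\<theta> u)" using aut[OF uz] sym by auto
        then show False
          using P4[of v u z "\<theta> u"] sym uv uz ne low_\<theta>[of u] moved[of u] nadj[of u] by metis
      qed
    qed
    have nhx: "\<not> adj x h" and nhy: "\<not> adj y h" if "h \<in> H" for h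
      using neg that sym x ly y unfolding N_def by blast+
    have "\<And>z. adj x z \<Longrightarrow> z = y"
      using only[of x y] y x ly nhx by blast
    moreover have "\<And>z. adj y z \<Longrightarrow> z = x"
      using only[of y x] y x ly nhy sym by blast
    ultimately have "x \<in> Z" unfolding Z_def using y(2) by blast
    with x show False by simp
  qed
  define M where "M h = N h \<union> (\<Union>y\<in>N h. N y)" for h
  have M4: "finite (M h) \<and> card (M h) \<le> 4" for h
  proof -
    have "card (\<Union>y\<in>N h. N y) \<le> (\<Sum>y\<in>N h. card (N y))" using N2 by (intro card_UN_le) auto
    also have "\<dots> \<le> (\<Sum>y\<in>N h. 1)" using Nlow by (intro sum_mono) (auto simp: N_def)
    also have "\<dots> \<le> 2" using N2[of h] by simp
    finally have "card (\<Union>y\<in>N h. N y) \<le> 2" .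
    moreover have "card (N h) \<le> 2" using N2 by blast
    ultimately have "card (M h) \<le> 4"
      unfolding M_def using card_Un_le[of "N h" "\<Union>y\<in>N h. N y"] by linarith
    then show ?thesis unfolding M_def using N2 by auto
  qed
  have finH: "finite H" using fin by (simp add: H_def)
  have "S \<subseteq> H \<union> Z \<union> (\<Union>h\<in>H. M h)"
  proof
    fix x assume "x \<in> S"
    then consider "x \<in> H" | "x \<in> Z" | "low x" "x \<notin> Z" unfolding H_def by blast
    then show "x \<in> H \<union> Z \<union> (\<Union>h\<in>H. M h)"
    proof cases
      case 3
      from key[OF \<open>x \<in> S\<close> 3] show ?thesis unfolding M_def by blast
    qed auto
  qed
  then have "card S \<le> card (H \<union> Z \<union> (\<Union>h\<in>H. M h))"
    using finH iso M4 by (intro card_mono) (auto simp: Z_def)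
  also have "\<dots> \<le> card H + card Z + card (\<Union>h\<in>H. M h)"
    by (meson add_le_mono card_Un_le le_refl le_trans)
  also have "card (\<Union>h\<in>H. M h) \<le> (\<Sum>h\<in>H. card (M h))" using finH by (intro card_UN_le)
  also have "(\<Sum>h\<in>H. card (M h)) \<le> (\<Sum>h\<in>H. 4)" using M4 by (intro sum_mono) auto
  finally have "card S \<le> card H + 2 + 4 * card H" using iso by (simp add: Z_def)
  then show ?thesis using S4 by (simp add: H_def)
qed

section \<open>Reconstruction and automorphisms\<close>

definition isolated_edges :: "('a \<times> 'b) set \<Rightarrow> ('a \<times> 'b) set" where
  "isolated_edges E = {(i, j) \<in> E. E `` {i} = {j} \<and> E\<inverse> `` {j} = {i}}"

definition automorphism ::
    "'a set \<Rightarrow> 'b set \<Rightarrow> ('a \<times> 'b) set \<Rightarrow> ('a \<Rightarrow> 'a) \<Rightarrow> ('b \<Rightarrow> 'b) \<Rightarrow> bool" where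
  "automorphism I J E \<sigma> \<rho> \<longleftrightarrow>
     \<sigma> permutes I \<and> \<rho> permutes J \<and> (\<forall>i j. (\<sigma> i, \<rho> j) \<in> E \<longleftrightarrow> (i, j) \<in> E)"

lemma image_mset_permutes:
  assumes "\<sigma> permutes A" "finite A"
  shows "image_mset (\<lambda>x. f (\<sigma> x)) (mset_set A) = image_mset f (mset_set A)"
proof -
  have "image_mset \<sigma> (mset_set A) = mset_set (\<sigma> ` A)"
    using assms(1) by (intro image_mset_mset_set) (rule permutes_inj_on)
  also have "\<dots> = mset_set A" using permutes_image[OF assms(1)] by simp
  finally have "image_mset f (image_mset \<sigma> (mset_set A)) = image_mset f (mset_set A)" by simp
  then show ?thesis by (simp add: image_mset.compositionality comp_def)
qed

text \<open>
  Permuting the rows by \<open>\<sigma>\<close> changes the columns in the same way as permuting the columns by the inverse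
  of \<open>\<rho>\<close>, so that neither multiset of neighbourhoods notices the change.
\<close>

lemma not_reconstructible_if_automorphism:
  assumes fin: "finite I" "finite J" and E: "E \<subseteq> I \<times> J"
    and aut: "automorphism I J E \<sigma> \<rho>"
    and ij: "(i, j) \<in> E" "(\<sigma> i, j) \<notin> E"
  shows "\<not> reconstructible I J E"
proof -
  have s: "\<sigma> permutes I" and r: "\<rho> permutes J"
    and a: "\<And>i j. (\<sigma> i, \<rho> j) \<in> E \<longleftrightarrow> (i, j) \<in> E"
    using aut by (auto simp: automorphism_def)
  define E' where "E' = {(i, j). (\<sigma> i, j) \<in> E}"
  have r': "inv \<rho> permutes J" using r by (rule permutes_inv)
  have sub: "E' \<subseteq> I \<times> J" using E permutes_in_image[OF s] by (auto simp: E'_def)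
  have rows: "E' `` {i} = E `` {\<sigma> i}" for i by (auto simp: E'_def)
  have cols: "E'\<inverse> `` {j} = E\<inverse> `` {inv \<rho> j}" for j
    using a[of _ "inv \<rho> j"] permutes_inverses(1)[OF r] by (auto simp: E'_def)
  have "unlabelled_balls I J E' = unlabelled_balls I J E"
    unfolding unlabelled_balls_def rows cols
    using image_mset_permutes[OF s fin(1), of "\<lambda>i. E `` {i}"]
      image_mset_permutes[OF r' fin(2), of "\<lambda>j. E\<inverse> `` {j}"] by simp
  moreover have "E' \<noteq> E" using ij by (auto simp: E'_def)
  ultimately show ?thesis using sub unfolding reconstructible_def by blast
qed

lemma not_reconstructible_if_two_isolated_edges:
  assumes fin: "finite I" "finite J" and E: "E \<subseteq> I \<times> J"
    and two: "card (isolated_edges E) \<ge> 2"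
  shows "\<not> reconstructible I J E"
proof -
  obtain e1 e2 where e: "e1 \<in> isolated_edges E" "e2 \<in> isolated_edges E" "e1 \<noteq> e2"
  proof -
    have "finite (isolated_edges E)" using two card.infinite by fastforce
    then have "\<not> (\<forall>x\<in>isolated_edges E. \<forall>y\<in>isolated_edges E. x = y)"
      using two card_le_Suc0_iff_eq[of "isolated_edges E"] by auto
    then show ?thesis using that by blast
  qed
  obtain i1 j1 i2 j2 where d: "e1 = (i1, j1)" "e2 = (i2, j2)" by fastforce
  have h: "(i1, j1) \<in> E" "(i2, j2) \<in> E"
    and r1: "\<And>j. (i1, j) \<in> E \<longleftrightarrow> j = j1" and c1: "\<And>i. (i, j1) \<in> E \<longleftrightarrow> i = i1"
    and r2: "\<And>j. (i2, j) \<in> E \<longleftrightarrow> j = j2" and c2: "\<And>i. (i, j2) \<in> E \<longleftrightarrow> i = i2"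
    using e d by (auto simp: isolated_edges_def)
  have ne: "i1 \<noteq> i2" "j1 \<noteq> j2" using e(3) d r1 c1 h by auto
  have "automorphism I J E (Transposition.transpose i1 i2) (Transposition.transpose j1 j2)"
    unfolding automorphism_def
  proof (intro conjI allI)
    show "Transposition.transpose i1 i2 permutes I" "Transposition.transpose j1 j2 permutes J"
      using h E by (auto intro!: permutes_swap_id)
    show "(Transposition.transpose i1 i2 i, Transposition.transpose j1 j2 j) \<in> E \<longleftrightarrow> (i, j) \<in> E" for i j
      using ne by (auto simp: Transposition.transpose_def r1 r2 c1 c2)
  qed
  moreover have "(Transposition.transpose i1 i2 i1, j1) \<notin> E" using r2 ne by simp
  ultimately show ?thesis using not_reconstructible_if_automorphism[OF fin E] h by blast
qed

text \<open>
  The permutation can be taken to fix every index at which the two families already agree: these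
  indices contribute equally to both multisets and can be cancelled.
\<close>

lemma permutation_matching_rows:
  assumes "finite A" and eq: "image_mset f (mset_set A) = image_mset g (mset_set A)"
  obtains \<sigma> where "\<sigma> permutes A" "\<And>x. x \<in> A \<Longrightarrow> f x = g (\<sigma> x)" "\<And>x. x \<in> A \<Longrightarrow> \<sigma> x \<noteq> x \<longleftrightarrow> f x \<noteq> g x"
proof -
  define D where "D = {x \<in> A. f x \<noteq> g x}"
  have D: "D \<subseteq> A" "finite D" "finite (A - D)" using assms(1) by (auto simp: D_def)
  have split: "mset_set A = mset_set D + mset_set (A - D)"
    using D mset_set_Union[of D "A - D"] by (metis Diff_disjoint Diff_partition)
  have "image_mset f (mset_set (A - D)) = image_mset g (mset_set (A - D))"
    using D by (intro image_mset_cong) (auto simp: D_def)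
  then have "image_mset f (mset_set D) = image_mset g (mset_set D)"
    using eq unfolding split by simp
  then obtain \<sigma> where s: "\<sigma> permutes D" "\<forall>x\<in>D. f x = g (\<sigma> x)"
    using image_mset_eq_implies_permutes[OF D(2)] by blast
  show ?thesis
  proof (rule that[of \<sigma>])
    show "\<sigma> permutes A" using s D by (auto intro: permutes_subset)
    show "f x = g (\<sigma> x)" if "x \<in> A" for x
      using s(2) permutes_not_in[OF s(1)] that by (cases "x \<in> D") (auto simp: D_def)
    show "\<sigma> x \<noteq> x \<longleftrightarrow> f x \<noteq> g x" if "x \<in> A" for x
      using s(2) permutes_not_in[OF s(1)] that by (cases "x \<in> D") (auto simp: D_def)
  qed
qed

text \<open>
  The moved rows and columns are exactly those in which the two graphs differ.  This minimality is what
  forces each moved vertex to have a moved neighbour; permutations of vertices with equal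
  neighbourhoods are excluded by it.
\<close>

lemma automorphism_of_not_reconstructible:
  assumes fin: "finite I" "finite J" and E: "E \<subseteq> I \<times> J"
    and nrec: "\<not> reconstructible I J E"
  obtains \<sigma> \<rho> where "automorphism I J E \<sigma> \<rho>" "\<exists>i. \<sigma> i \<noteq> i" "\<exists>j. \<rho> j \<noteq> j"
    "\<And>i. \<sigma> i \<noteq> i \<Longrightarrow> \<exists>j. \<rho> j \<noteq> j \<and> (i, j) \<in> E"
    "\<And>j. \<rho> j \<noteq> j \<Longrightarrow> \<exists>i. \<sigma> i \<noteq> i \<and> (i, j) \<in> E"
proof -
  obtain E' where E': "E' \<subseteq> I \<times> J" and ne: "E' \<noteq> E"
    and balls: "unlabelled_balls I J E' = unlabelled_balls I J E"
    using nrec unfolding reconstructible_def by blast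
  have rows: "image_mset (\<lambda>i. E `` {i}) (mset_set I) = image_mset (\<lambda>i. E' `` {i}) (mset_set I)"
    and cols: "image_mset (\<lambda>j. E'\<inverse> `` {j}) (mset_set J) = image_mset (\<lambda>j. E\<inverse> `` {j}) (mset_set J)"
    using balls by (auto simp: unlabelled_balls_def)
  obtain \<sigma> where s: "\<sigma> permutes I" and s1: "\<And>i. i \<in> I \<Longrightarrow> E `` {i} = E' `` {\<sigma> i}"
    and s2: "\<And>i. i \<in> I \<Longrightarrow> \<sigma> i \<noteq> i \<longleftrightarrow> E `` {i} \<noteq> E' `` {i}"
    using permutation_matching_rows[OF fin(1) rows] by blast
  obtain \<rho> where r: "\<rho> permutes J" and r1: "\<And>j. j \<in> J \<Longrightarrow> E'\<inverse> `` {j} = E\<inverse> `` {\<rho> j}"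
    and r2: "\<And>j. j \<in> J \<Longrightarrow> \<rho> j \<noteq> j \<longleftrightarrow> E'\<inverse> `` {j} \<noteq> E\<inverse> `` {j}"
    using permutation_matching_rows[OF fin(2) cols] by blast
  have S: "(i, j) \<in> E \<longleftrightarrow> (\<sigma> i, j) \<in> E'" for i j
    using s1[of i] E E' permutes_in_image[OF s, of i] by (cases "i \<in> I") auto
  have R: "(i, j) \<in> E' \<longleftrightarrow> (i, \<rho> j) \<in> E" for i j
    using r1[of j] E E' permutes_in_image[OF r, of j] by (cases "j \<in> J") auto
  have aut: "automorphism I J E \<sigma> \<rho>" using s r S R by (auto simp: automorphism_def)
  have ms: "\<sigma> i \<noteq> i \<longleftrightarrow> (\<exists>j. ((i, j) \<in> E) \<noteq> ((i, j) \<in> E'))" for i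
    using s2[of i] E E' permutes_not_in[OF s, of i] by (cases "i \<in> I") auto
  have mr: "\<rho> j \<noteq> j \<longleftrightarrow> (\<exists>i. ((i, j) \<in> E) \<noteq> ((i, j) \<in> E'))" for j
    using r2[of j] E E' permutes_not_in[OF r, of j] by (cases "j \<in> J") auto
  obtain a b where ab: "((a, b) \<in> E) \<noteq> ((a, b) \<in> E')" using ne by auto
  have nbr1: "\<exists>j. \<rho> j \<noteq> j \<and> (i, j) \<in> E" if i: "\<sigma> i \<noteq> i" for i
  proof -
    \<comment> \<open>The \<open>E\<close>-row of \<open>i\<close> is the \<open>E'\<close>-row of \<open>\<sigma> i\<close>, and \<open>\<sigma> i\<close> is a moved row as well, so
        that these rows differ from the \<open>E\<close>-row of \<open>\<sigma> i\<close> in some moved column.\<close>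
    have "\<sigma> (\<sigma> i) \<noteq> \<sigma> i" using i permutes_inj[OF s] by (auto dest: injD)
    then obtain j where j: "((\<sigma> i, j) \<in> E) \<noteq> ((\<sigma> i, j) \<in> E')" using ms by blast
    then have mj: "\<rho> j \<noteq> j" using mr by blast
    define k where "k = inv \<rho> j"
    have k: "\<rho> k = j" using permutes_inverses(1)[OF r] by (simp add: k_def)
    have "\<rho> k \<noteq> k" using mj k by auto
    have "(\<sigma> i, j) \<in> E \<longleftrightarrow> (i, k) \<in> E" using aut k unfolding automorphism_def by blast
    then show ?thesis using j S mj \<open>\<rho> k \<noteq> k\<close> by blast
  qed
  have nbr2: "\<exists>i. \<sigma> i \<noteq> i \<and> (i, j) \<in> E" if j: "\<rho> j \<noteq> j" for j
  proof -
    obtain i where i: "((i, j) \<in> E) \<noteq> ((i, j) \<in> E')" using j mr by blast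
    then have mi: "\<sigma> i \<noteq> i" using ms by blast
    define k where "k = inv \<sigma> i"
    have k: "\<sigma> k = i" using permutes_inverses(1)[OF s] by (simp add: k_def)
    have "\<sigma> k \<noteq> k" using mi k by auto
    then show ?thesis using i S[of k j] k mi by auto
  qed
  show ?thesis by (rule that[OF aut _ _ nbr1 nbr2]) (use ab ms mr in blast)+
qed

section \<open>Counting edges at moved vertices\<close>

text \<open>
  A configuration \<open>(F, D, K)\<close> consists of the edges \<open>F\<close> of a small tree and of the rows \<open>D\<close> and columns \<open>K\<close>
  on it that are required to have low degree.  The bound 120 is what makes a tenth of \<open>s\<close> moved vertices
  of high degree account for \<open>6 s\<close> edges, when every edge may be counted from both ends.
\<close>

definition low_config :: "('a \<times> 'b) set \<Rightarrow> ('a \<times> 'b) set \<times> 'a set \<times> 'b set \<Rightarrow> bool" where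
  "low_config E = (\<lambda>(F, D, K). F \<subseteq> E \<and> (\<forall>i\<in>D. card (E `` {i}) < 120) \<and>
     (\<forall>j\<in>K. card (E\<inverse> `` {j}) < 120))"

text \<open>
  Up to exchanging rows and columns: a path \<open>i j i'\<close> with all three vertices low.
\<close>

definition two_edge_configs :: "'a set \<Rightarrow> 'b set \<Rightarrow> (('a \<times> 'b) set \<times> 'a set \<times> 'b set) set" where
  "two_edge_configs I J =
     (\<lambda>(i, i', j). ({(i, j), (i', j)}, {i, i'}, {j})) ` {(i, i', j) \<in> I \<times> I \<times> J. i \<noteq> i'} \<union>
     (\<lambda>(i, j, j'). ({(i, j), (i, j')}, {i}, {j, j'})) ` {(i, j, j') \<in> I \<times> J \<times> J. j \<noteq> j'}"

text \<open>
  Up to exchanging rows and columns: a path \<open>i j i' j'\<close> with all vertices but the third low, and a star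
  with three low leaves.
\<close>

definition three_edge_configs :: "'a set \<Rightarrow> 'b set \<Rightarrow> (('a \<times> 'b) set \<times> 'a set \<times> 'b set) set" where
  "three_edge_configs I J =
     (\<lambda>(i, i', j, j'). ({(i, j), (i', j), (i', j')}, {i}, {j, j'})) `
        {(i, i', j, j') \<in> I \<times> I \<times> J \<times> J. i \<noteq> i' \<and> j \<noteq> j'} \<union>
     (\<lambda>(i, i', j, j'). ({(i, j), (i, j'), (i', j')}, {i, i'}, {j})) `
        {(i, i', j, j') \<in> I \<times> I \<times> J \<times> J. i \<noteq> i' \<and> j \<noteq> j'} \<union>
     (\<lambda>(i, i', i'', j). ({(i, j), (i', j), (i'', j)}, {i, i', i''}, {})) `
        {(i, i', i'', j) \<in> I \<times> I \<times> I \<times> J. i \<noteq> i' \<and> i' \<noteq> i'' \<and> i \<noteq> i''} \<union>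
     (\<lambda>(i, j, j', j''). ({(i, j), (i, j'), (i, j'')}, {}, {j, j', j''})) `
        {(i, j, j', j'') \<in> I \<times> J \<times> J \<times> J. j \<noteq> j' \<and> j' \<noteq> j'' \<and> j \<noteq> j''}"

definition moved_cells ::
    "'a set \<Rightarrow> 'b set \<Rightarrow> ('a \<Rightarrow> 'a) \<Rightarrow> ('b \<Rightarrow> 'b) \<Rightarrow> ('a \<times> 'b) set" where
  "moved_cells I J \<sigma> \<rho> = {(i, j) \<in> I \<times> J. \<sigma> i \<noteq> i \<or> \<rho> j \<noteq> j}"

lemma configs_intros:
  "i \<in> I \<Longrightarrow> i' \<in> I \<Longrightarrow> j \<in> J \<Longrightarrow> i \<noteq> i' \<Longrightarrow>
    ({(i, j), (i', j)}, {i, i'}, {j}) \<in> two_edge_configs I J"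
  "i \<in> I \<Longrightarrow> j \<in> J \<Longrightarrow> j' \<in> J \<Longrightarrow> j \<noteq> j' \<Longrightarrow>
    ({(i, j), (i, j')}, {i}, {j, j'}) \<in> two_edge_configs I J"
  "i \<in> I \<Longrightarrow> i' \<in> I \<Longrightarrow> j \<in> J \<Longrightarrow> j' \<in> J \<Longrightarrow> i \<noteq> i' \<Longrightarrow> j \<noteq> j' \<Longrightarrow>
    ({(i, j), (i', j), (i', j')}, {i}, {j, j'}) \<in> three_edge_configs I J"
  "i \<in> I \<Longrightarrow> i' \<in> I \<Longrightarrow> j \<in> J \<Longrightarrow> j' \<in> J \<Longrightarrow> i \<noteq> i' \<Longrightarrow> j \<noteq> j' \<Longrightarrow>
    ({(i, j), (i, j'), (i', j')}, {i, i'}, {j}) \<in> three_edge_configs I J"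
  "i \<in> I \<Longrightarrow> i' \<in> I \<Longrightarrow> i'' \<in> I \<Longrightarrow> j \<in> J \<Longrightarrow> i \<noteq> i' \<Longrightarrow> i' \<noteq> i'' \<Longrightarrow> i \<noteq> i'' \<Longrightarrow>
    ({(i, j), (i', j), (i'', j)}, {i, i', i''}, {}) \<in> three_edge_configs I J"
  "i \<in> I \<Longrightarrow> j \<in> J \<Longrightarrow> j' \<in> J \<Longrightarrow> j'' \<in> J \<Longrightarrow> j \<noteq> j' \<Longrightarrow> j' \<noteq> j'' \<Longrightarrow> j \<noteq> j'' \<Longrightarrow>
    ({(i, j), (i, j'), (i, j'')}, {}, {j, j', j''}) \<in> three_edge_configs I J"
  unfolding two_edge_configs_def three_edge_configs_def Un_iff image_iff
  by (rule disjI1, rule bexI[of _ "(i, i', j)"], simp, simp,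
      rule disjI2, rule bexI[of _ "(i, j, j')"], simp, simp,
      rule disjI1, rule disjI1, rule disjI1, rule bexI[of _ "(i, i', j, j')"], simp, simp,
      rule disjI1, rule disjI1, rule disjI2, rule bexI[of _ "(i, i', j, j')"], simp, simp,
      rule disjI1, rule disjI2, rule bexI[of _ "(i, i', i'', j)"], simp, simp,
      rule disjI2, rule bexI[of _ "(i, j, j', j'')"], simp, simp)

lemma card_moved_ge_2:
  assumes s: "\<sigma> permutes A" and "finite A" "\<sigma> x \<noteq> x"
  shows "finite {x. \<sigma> x \<noteq> x}" "card {x. \<sigma> x \<noteq> x} \<ge> 2"
proof -
  have "{x. \<sigma> x \<noteq> x} \<subseteq> A" using permutes_not_in[OF s] by blast
  then show f: "finite {x. \<sigma> x \<noteq> x}" using assms(2) finite_subset by blast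
  have "\<sigma> (\<sigma> x) \<noteq> \<sigma> x" using assms(3) permutes_inj[OF s] by (auto dest: injD)
  then have "card {x, \<sigma> x} \<le> card {x. \<sigma> x \<noteq> x}" using assms(3) f by (intro card_mono) auto
  then show "card {x. \<sigma> x \<noteq> x} \<ge> 2" using assms(3) by simp
qed

lemma automorphism_card_row:
  assumes "automorphism I J E \<sigma> \<rho>"
  shows "card (E `` {\<sigma> i}) = card (E `` {i})"
proof -
  have r: "\<rho> permutes J" and a: "\<And>i j. (\<sigma> i, \<rho> j) \<in> E \<longleftrightarrow> (i, j) \<in> E"
    using assms by (auto simp: automorphism_def)
  have "E `` {\<sigma> i} = \<rho> ` (E `` {i})"
  proof (intro equalityI subsetI)
    fix j assume "j \<in> E `` {\<sigma> i}"
    then have "(\<sigma> i, \<rho> (inv \<rho> j)) \<in> E" using permutes_inverses(1)[OF r] by simp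
    then have "inv \<rho> j \<in> E `` {i}" using a by blast
    then show "j \<in> \<rho> ` (E `` {i})" using permutes_inverses(1)[OF r, of j] by (metis imageI)
  qed (use a in auto)
  then show ?thesis using permutes_inj_on[OF r] by (simp add: card_image)
qed

lemma automorphism_converse:
  "automorphism J I (E\<inverse>) \<rho> \<sigma> \<longleftrightarrow> automorphism I J E \<sigma> \<rho>"
  by (auto simp: automorphism_def)

lemma card_edges_ge_of_degrees:
  fixes E :: "('a \<times> 'b) set"
  assumes "finite E" "A \<subseteq> E" "finite D"
    and "\<And>i. i \<in> D \<Longrightarrow> d \<le> card (E `` {i})" "\<And>i j. i \<in> D \<Longrightarrow> (i, j) \<in> E \<Longrightarrow> (i, j) \<in> A"
  shows "d * card D \<le> card A"
proof -
  have "d * card D = (\<Sum>i\<in>D. d)" by simp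
  also have "\<dots> \<le> (\<Sum>i\<in>D. card (E `` {i}))" using assms(4) by (rule sum_mono)
  also have "\<dots> = card (SIGMA i:D. E `` {i})"
    using assms(1,3) by (intro card_SigmaI[symmetric]) (auto intro: finite_Image)
  also have "\<dots> \<le> card A"
    using assms by (intro card_mono) (auto intro: finite_subset)
  finally show ?thesis .
qed

text \<open>
  The graph on the disjoint union of rows and columns, to which the argument for abstract graphs
  applies.
\<close>

fun bip_adj :: "('a \<times> 'b) set \<Rightarrow> 'a + 'b \<Rightarrow> 'a + 'b \<Rightarrow> bool" where
  "bip_adj E (Inl i) (Inr j) \<longleftrightarrow> (i, j) \<in> E"
| "bip_adj E (Inr j) (Inl i) \<longleftrightarrow> (i, j) \<in> E"
| "bip_adj E _ _ \<longleftrightarrow> False"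

fun bip_low :: "('a \<times> 'b) set \<Rightarrow> 'a + 'b \<Rightarrow> bool" where
  "bip_low E (Inl i) \<longleftrightarrow> card (E `` {i}) < 120"
| "bip_low E (Inr j) \<longleftrightarrow> card (E\<inverse> `` {j}) < 120"

lemma bip_adj_iff:
  "bip_adj E (Inl i) x \<longleftrightarrow> (\<exists>j. x = Inr j \<and> (i, j) \<in> E)"
  "bip_adj E x (Inl i) \<longleftrightarrow> (\<exists>j. x = Inr j \<and> (i, j) \<in> E)"
  "bip_adj E (Inr j) x \<longleftrightarrow> (\<exists>i. x = Inl i \<and> (i, j) \<in> E)"
  "bip_adj E x (Inr j) \<longleftrightarrow> (\<exists>i. x = Inl i \<and> (i, j) \<in> E)"
  by (cases x; simp)+

lemma bip_adj_sym: "bip_adj E x y \<Longrightarrow> bip_adj E y x"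
  by (cases x; cases y) auto

lemma bip_adj_map_sum:
  assumes "automorphism I J E \<sigma> \<rho>" "bip_adj E x y"
  shows "bip_adj E (map_sum \<sigma> \<rho> x) (map_sum \<sigma> \<rho> y)"
  using assms by (cases x; cases y) (auto simp: automorphism_def)

lemma isolated_vertices_card_le:
  fixes E :: "('a \<times> 'b) set"
  assumes f: "finite (isolated_edges E)"
  defines "Z \<equiv> {x. \<exists>y. bip_adj E x y \<and> (\<forall>z. bip_adj E x z \<longrightarrow> z = y) \<and> (\<forall>z. bip_adj E y z \<longrightarrow> z = x)}"
  shows "finite Z \<and> card Z \<le> 2 * card (isolated_edges E)"
proof -
  let ?U = "(Inl \<circ> fst) ` isolated_edges E \<union> (Inr \<circ> snd) ` isolated_edges E :: ('a + 'b) set"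
  have sub: "Z \<subseteq> ?U"
  proof
    fix x assume "x \<in> Z"
    then obtain y where y: "bip_adj E x y" "\<And>z. bip_adj E x z \<Longrightarrow> z = y" "\<And>z. bip_adj E y z \<Longrightarrow> z = x"
      unfolding Z_def by blast
    show "x \<in> ?U"
    proof (cases x)
      case (Inl i)
      then obtain j where j: "y = Inr j" "(i, j) \<in> E" using y(1) by (cases y) auto
      have "k = j" if "(i, k) \<in> E" for k using y(2)[of "Inr k"] j Inl that by simp
      moreover have "k = i" if "(k, j) \<in> E" for k using y(3)[of "Inl k"] j Inl that by simp
      ultimately have "E `` {i} = {j}" "E\<inverse> `` {j} = {i}" using j(2) by blast+
      then have "(i, j) \<in> isolated_edges E" using j by (simp add: isolated_edges_def)
      then show ?thesis using Inl by (intro UnI1 image_eqI[of _ _ "(i, j)"]) auto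
    next
      case (Inr j)
      then obtain i where i: "y = Inl i" "(i, j) \<in> E" using y(1) by (cases y) auto
      have "k = i" if "(k, j) \<in> E" for k using y(2)[of "Inl k"] i Inr that by simp
      moreover have "k = j" if "(i, k) \<in> E" for k using y(3)[of "Inr k"] i Inr that by simp
      ultimately have "E `` {i} = {j}" "E\<inverse> `` {j} = {i}" using i(2) by blast+
      then have "(i, j) \<in> isolated_edges E" using i by (simp add: isolated_edges_def)
      then show ?thesis using Inr by (intro UnI2 image_eqI[of _ _ "(i, j)"]) auto
    qed
  qed
  have fU: "finite ?U" using f by simp
  have "card Z \<le> card ?U" by (rule card_mono[OF fU sub])
  also have "\<dots> \<le> card (isolated_edges E) + card (isolated_edges E)"
    by (intro order.trans[OF card_Un_le] add_mono card_image_le f)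
  finally show ?thesis using finite_subset[OF sub fU] by simp
qed

text \<open>
  At least a tenth of the moved vertices have degree 120 or more.  The larger of the two classes of
  these accounts alone for the claimed number of edges.
\<close>

lemma automorphism_many_moved_edges:
  assumes fin: "finite I" "finite J" and E: "E \<subseteq> I \<times> J"
    and nrec: "\<not> reconstructible I J E" and iso: "card (isolated_edges E) \<le> 1"
    and low2: "\<And>t. t \<in> two_edge_configs I J \<Longrightarrow> \<not> low_config E t"
    and low3: "\<And>t. t \<in> three_edge_configs I J \<Longrightarrow> \<not> low_config E t"
  obtains \<sigma> \<rho> where "automorphism I J E \<sigma> \<rho>" "\<sigma> \<noteq> id" "\<rho> \<noteq> id"
    "6 * (card {i. \<sigma> i \<noteq> i} + card {j. \<rho> j \<noteq> j}) \<le> card (E \<inter> moved_cells I J \<sigma> \<rho>)"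
proof -
  have finE: "finite E" using E fin finite_subset by blast
  obtain \<sigma> \<rho> where aut: "automorphism I J E \<sigma> \<rho>" and ex: "\<exists>i. \<sigma> i \<noteq> i" "\<exists>j. \<rho> j \<noteq> j"
    and nbr1: "\<And>i. \<sigma> i \<noteq> i \<Longrightarrow> \<exists>j. \<rho> j \<noteq> j \<and> (i, j) \<in> E"
    and nbr2: "\<And>j. \<rho> j \<noteq> j \<Longrightarrow> \<exists>i. \<sigma> i \<noteq> i \<and> (i, j) \<in> E"
    using automorphism_of_not_reconstructible[OF fin E nrec] by blast
  have s: "\<sigma> permutes I" and r: "\<rho> permutes J"
    using aut by (auto simp: automorphism_def)
  define D where "D = {i. \<sigma> i \<noteq> i}"
  define K where "K = {j. \<rho> j \<noteq> j}"
  have D: "finite D" "card D \<ge> 2" using ex(1) card_moved_ge_2[OF s fin(1)] by (auto simp: D_def)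
  have K: "finite K" "card K \<ge> 2" using ex(2) card_moved_ge_2[OF r fin(2)] by (auto simp: K_def)
  define S where "S = Inl ` D \<union> Inr ` K"
  define \<theta> where "\<theta> = map_sum \<sigma> \<rho>"
  have disj: "Inl ` A \<inter> Inr ` B = {}" for A :: "'a set" and B :: "'b set" by auto
  have cS: "card (Inl ` A \<union> Inr ` B) = card A + card B" if "finite A" "finite B"
    for A :: "'a set" and B :: "'b set"
    using that disj[of A B] by (subst card_Un_disjoint) (auto simp: card_image)
  have IJ: "i \<in> I" "j \<in> J" if "(i, j) \<in> E" for i j using that E by auto
  have P3: False if h: "bip_adj E x y" "bip_adj E y z" "x \<noteq> z" "bip_low E x" "bip_low E y" "bip_low E z"
    for x y z
  proof (cases y)
    case (Inr j)
    then obtain i i' where i: "x = Inl i" "z = Inl i'" "(i, j) \<in> E" "(i', j) \<in> E"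
      using h(1,2) by (auto simp: bip_adj_iff)
    have "({(i, j), (i', j)}, {i, i'}, {j}) \<in> two_edge_configs I J"
      using h(3) i IJ by (intro configs_intros) auto
    from low2[OF this] show False using h(4-6) i Inr by (simp add: low_config_def)
  next
    case (Inl i)
    then obtain j j' where j: "x = Inr j" "z = Inr j'" "(i, j) \<in> E" "(i, j') \<in> E"
      using h(1,2) by (auto simp: bip_adj_iff)
    have "({(i, j), (i, j')}, {i}, {j, j'}) \<in> two_edge_configs I J"
      using h(3) j IJ by (intro configs_intros) auto
    from low2[OF this] show False using h(4-6) j Inl by (simp add: low_config_def)
  qed
  have P4: False if h: "bip_adj E x y" "bip_adj E y w" "bip_adj E w z" "x \<noteq> w" "y \<noteq> z"
    "bip_low E x" "bip_low E y" "bip_low E z" for x y w z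
  proof (cases x)
    case (Inl i)
    then obtain i' j j' where i: "y = Inr j" "w = Inl i'" "z = Inr j'"
        "(i, j) \<in> E" "(i', j) \<in> E" "(i', j') \<in> E"
      using h(1-3) by (auto simp: bip_adj_iff)
    have "({(i, j), (i', j), (i', j')}, {i}, {j, j'}) \<in> three_edge_configs I J"
      using h(4,5) i Inl IJ by (intro configs_intros) auto
    from low3[OF this] show False using h(6-8) i Inl by (simp add: low_config_def)
  next
    case (Inr j)
    then obtain i i' j' where j: "y = Inl i" "w = Inr j'" "z = Inl i'"
        "(i, j) \<in> E" "(i, j') \<in> E" "(i', j') \<in> E"
      using h(1-3) by (auto simp: bip_adj_iff)
    have "({(i, j), (i, j'), (i', j')}, {i, i'}, {j}) \<in> three_edge_configs I J"
      using h(4,5) j Inr IJ by (intro configs_intros) auto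
    from low3[OF this] show False using h(6-8) j Inr by (simp add: low_config_def)
  qed
  have St: False if h: "bip_adj E v x" "bip_adj E v y" "bip_adj E v z" "x \<noteq> y" "y \<noteq> z" "x \<noteq> z"
    "bip_low E x" "bip_low E y" "bip_low E z" for v x y z
  proof (cases v)
    case (Inr j)
    then obtain i i' i'' where i: "x = Inl i" "y = Inl i'" "z = Inl i''"
        "(i, j) \<in> E" "(i', j) \<in> E" "(i'', j) \<in> E"
      using h(1-3) by (auto simp: bip_adj_iff)
    have "({(i, j), (i', j), (i'', j)}, {i, i', i''}, {}) \<in> three_edge_configs I J"
      using h(4-6) i IJ by (intro configs_intros) auto
    from low3[OF this] show False using h(7-9) i by (simp add: low_config_def)
  next
    case (Inl i)
    then obtain j j' j'' where j: "x = Inr j" "y = Inr j'" "z = Inr j''"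
        "(i, j) \<in> E" "(i, j') \<in> E" "(i, j'') \<in> E"
      using h(1-3) by (auto simp: bip_adj_iff)
    have "({(i, j), (i, j'), (i, j'')}, {}, {j, j', j''}) \<in> three_edge_configs I J"
      using h(4-6) j IJ by (intro configs_intros) auto
    from low3[OF this] show False using h(7-9) j by (simp add: low_config_def)
  qed
  have fiso: "finite (isolated_edges E)"
    using finE by (rule rev_finite_subset) (auto simp: isolated_edges_def)
  have "card S \<le> 10 * card {x \<in> S. \<not> bip_low E x}"
  proof (rule card_moved_le_card_high[where adj = "bip_adj E" and \<theta> = \<theta>])
    show "bip_adj E x y \<Longrightarrow> bip_adj E y x" for x y by (rule bip_adj_sym)
    show "\<not> bip_adj E x x" "\<not> bip_adj E x (\<theta> x)" for x by (cases x; simp add: \<theta>_def)+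
    show "bip_adj E x y \<Longrightarrow> bip_adj E (\<theta> x) (\<theta> y)" for x y
      unfolding \<theta>_def by (rule bip_adj_map_sum[OF aut])
    show "finite S" "card S \<ge> 4" using D K by (auto simp: S_def cS)
    show "x \<in> S \<longleftrightarrow> \<theta> x \<noteq> x" for x by (cases x) (auto simp: S_def D_def K_def \<theta>_def)
    show "bip_low E x \<Longrightarrow> bip_low E (\<theta> x)" for x
      using automorphism_card_row[OF aut] automorphism_card_row[OF iffD2[OF automorphism_converse aut]]
      by (cases x) (auto simp: \<theta>_def)
    show "\<exists>y\<in>S. bip_adj E x y" if "x \<in> S" for x
    proof (cases x)
      case (Inl i)
      then have "\<sigma> i \<noteq> i" using that by (auto simp: S_def D_def)
      from nbr1[OF this] Inl show ?thesis by (force simp: S_def K_def)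
    next
      case (Inr j)
      then have "\<rho> j \<noteq> j" using that by (auto simp: S_def K_def)
      from nbr2[OF this] Inr show ?thesis by (force simp: S_def D_def)
    qed
  next
    have "2 * card (isolated_edges E) \<le> 2" using iso by simp
    then show "finite {x. \<exists>y. bip_adj E x y \<and> (\<forall>z. bip_adj E x z \<longrightarrow> z = y) \<and> (\<forall>z. bip_adj E y z \<longrightarrow> z = x)} \<and>
              card {x. \<exists>y. bip_adj E x y \<and> (\<forall>z. bip_adj E x z \<longrightarrow> z = y) \<and> (\<forall>z. bip_adj E y z \<longrightarrow> z = x)} \<le> 2"
      using isolated_vertices_card_le[OF fiso] le_trans by blast
  next
    fix x y z w
    assume h: "bip_low E x" "bip_low E y" "bip_low E z" "x \<noteq> z"
    show False if "bip_adj E x y" "bip_adj E y z" using P3 that h by blast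
    show False if "bip_adj E x y" "bip_adj E y w" "bip_adj E w z" "x \<noteq> w" "y \<noteq> z"
      using P4 that h by blast
    show False if "bip_adj E w x" "bip_adj E w y" "bip_adj E w z" "x \<noteq> y" "y \<noteq> z"
      using St that h by blast
  qed
  moreover have "{x \<in> S. \<not> bip_low E x} =
      Inl ` {i \<in> D. 120 \<le> card (E `` {i})} \<union> Inr ` {j \<in> K. 120 \<le> card (E\<inverse> `` {j})}"
    by (auto simp: S_def not_less)
  ultimately have a: "card D + card K \<le>
      10 * (card {i \<in> D. 120 \<le> card (E `` {i})} + card {j \<in> K. 120 \<le> card (E\<inverse> `` {j})})"
    using D K by (simp add: S_def cS)
  let ?A = "E \<inter> moved_cells I J \<sigma> \<rho>"
  have b: "120 * card {i \<in> D. 120 \<le> card (E `` {i})} \<le> card ?A"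
    using finE D(1) E by (intro card_edges_ge_of_degrees[of E]) (auto simp: moved_cells_def D_def)
  have "120 * card {j \<in> K. 120 \<le> card (E\<inverse> `` {j})} \<le> card (?A\<inverse>)"
    using finE K(1) E by (intro card_edges_ge_of_degrees[of "E\<inverse>"]) (auto simp: moved_cells_def K_def)
  then have c: "120 * card {j \<in> K. 120 \<le> card (E\<inverse> `` {j})} \<le> card ?A" by simp
  have "6 * (d + k) \<le> A" if "d + k \<le> 10 * (h + h')" "120 * h \<le> A" "120 * h' \<le> A"
    for d k h h' A :: nat
  proof -
    have "2 * (6 * (d + k)) \<le> 120 * h + 120 * h'" using that(1) by simp
    also have "\<dots> \<le> A + A" by (rule add_mono[OF that(2,3)])
    finally show ?thesis by simp
  qed
  from this[OF a b c] have "6 * (card {i. \<sigma> i \<noteq> i} + card {j. \<rho> j \<noteq> j}) \<le> card ?A"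
    by (simp only: D_def K_def)
  moreover have "\<sigma> \<noteq> id" "\<rho> \<noteq> id" using ex by auto
  ultimately show ?thesis using that[OF aut] by blast
qed

section \<open>Probabilities of prescribed, sparse and invariant graphs\<close>

lemma set_pmf_random_subgraph: "set_pmf (random_subgraph I J p) \<subseteq> Pow (I \<times> J)"
  by (auto simp: random_subgraph_def)

lemma prob_random_subgraph_mono:
  assumes "\<And>E. E \<subseteq> I \<times> J \<Longrightarrow> A E \<Longrightarrow> B E"
  shows "measure_pmf.prob (random_subgraph I J p) {E. A E} \<le> measure_pmf.prob (random_subgraph I J p) {E. B E}"
proof (rule measure_pmf.finite_measure_mono_AE)
  show "AE E in measure_pmf (random_subgraph I J p). E \<in> {E. A E} \<longrightarrow> E \<in> {E. B E}"
    using assms set_pmf_random_subgraph[of I J p] by (auto simp: AE_measure_pmf_iff)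
qed simp

lemma prob_random_subgraph_cylinder:
  assumes fin: "finite I" "finite J" and p: "0 \<le> p" "p \<le> 1"
    and X: "X \<subseteq> I \<times> J" and Y: "Y \<subseteq> I \<times> J" and disj: "X \<inter> Y = {}"
  shows "measure_pmf.prob (random_subgraph I J p) {E. X \<subseteq> E \<and> E \<inter> Y = {}} = p ^ card X * (1 - p) ^ card Y"
proof -
  let ?C = "I \<times> J"
  let ?B = "\<lambda>e. if e \<in> X then {True} else if e \<in> Y then {False} else UNIV"
  have fC: "finite ?C" using fin by simp
  have "(\<lambda>\<omega>. {e \<in> ?C. \<omega> e}) -` {E. X \<subseteq> E \<and> E \<inter> Y = {}} = Pi ?C ?B"
  proof (rule set_eqI)
    fix \<omega> :: "'a \<times> 'b \<Rightarrow> bool"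
    have "\<omega> \<in> Pi ?C ?B \<longleftrightarrow> (\<forall>e\<in>X. \<omega> e) \<and> (\<forall>e\<in>Y. \<not> \<omega> e)" (is "?l \<longleftrightarrow> ?r")
    proof
      assume l: ?l
      have "\<omega> e" if "e \<in> X" for e using Pi_mem[OF l, of e] X that by auto
      moreover have "\<not> \<omega> e" if "e \<in> Y" for e
      proof -
        have "e \<notin> X" "e \<in> ?C" using Y disj that by blast+
        then show ?thesis using Pi_mem[OF l, of e] that by simp
      qed
      ultimately show ?r by blast
    next
      assume ?r
      then show ?l by (intro Pi_I) auto
    qed
    also have "\<dots> \<longleftrightarrow> \<omega> \<in> (\<lambda>\<omega>. {e \<in> ?C. \<omega> e}) -` {E. X \<subseteq> E \<and> E \<inter> Y = {}}"
      using X Y by blast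
    finally show "\<omega> \<in> (\<lambda>\<omega>. {e \<in> ?C. \<omega> e}) -` {E. X \<subseteq> E \<and> E \<inter> Y = {}} \<longleftrightarrow> \<omega> \<in> Pi ?C ?B" ..
  qed
  then have "measure_pmf.prob (random_subgraph I J p) {E. X \<subseteq> E \<and> E \<inter> Y = {}} =
      measure_pmf.prob (Pi_pmf ?C False (\<lambda>_. bernoulli_pmf p)) (Pi ?C ?B)"
    unfolding random_subgraph_def by (simp only: measure_map_pmf)
  also have "\<dots> = (\<Prod>e\<in>?C. measure_pmf.prob (bernoulli_pmf p) (?B e))"
    using fC by (rule measure_Pi_pmf_Pi)
  also have "\<dots> = (\<Prod>e\<in>?C. (if e \<in> X then p else 1) * (if e \<in> Y then 1 - p else 1))"
    using p disj by (intro prod.cong refl) (auto simp: measure_pmf_single)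
  also have "\<dots> = (\<Prod>e\<in>?C. if e \<in> X then p else 1) * (\<Prod>e\<in>?C. if e \<in> Y then 1 - p else 1)"
    by (rule prod.distrib)
  also have "\<dots> = p ^ card (?C \<inter> X) * (1 - p) ^ card (?C \<inter> Y)"
    using fC by (simp add: prod.If_cases)
  finally show ?thesis using X Y by (simp add: Int_absorb1)
qed

lemma sum_Pow_power:
  fixes a b :: real
  assumes "finite N"
  shows "(\<Sum>B\<in>Pow N. a ^ card B * b ^ card (N - B)) = (a + b) ^ card N"
  using prod_add[OF assms, of "\<lambda>_. a" "\<lambda>_. b"] by simp

text \<open>
  Exponential Markov inequality: each configuration of at most \<open>m\<close> edges is given the extra weight
  \<open>t\<^bsup>|B| - m\<^esup> \<ge> 1\<close>, after which the sum over all configurations factorises.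
\<close>

lemma prob_few_edges:
  assumes fin: "finite I" "finite J" and p: "0 \<le> p" "p \<le> 1"
    and F: "F \<subseteq> I \<times> J" and N: "N \<subseteq> I \<times> J" and disj: "F \<inter> N = {}" and t: "0 < t" "t \<le> 1"
  shows "measure_pmf.prob (random_subgraph I J p) {E. F \<subseteq> E \<and> card (E \<inter> N) \<le> m} \<le>
    p ^ card F * (1 / t) ^ m * (t * p + (1 - p)) ^ card N"
proof -
  let ?P = "measure_pmf.prob (random_subgraph I J p)"
  let ?S = "{B \<in> Pow N. card B \<le> m}"
  have fN: "finite N" "finite F" using N F fin by (auto intro: finite_subset)
  have "?P {E. F \<subseteq> E \<and> card (E \<inter> N) \<le> m} \<le> ?P (\<Union>B\<in>?S. {E. F \<union> B \<subseteq> E \<and> E \<inter> (N - B) = {}})"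
    by (intro measure_pmf.finite_measure_mono) auto
  also have "\<dots> \<le> (\<Sum>B\<in>?S. ?P {E. F \<union> B \<subseteq> E \<and> E \<inter> (N - B) = {}})"
    using fN by (intro measure_UNION_le) auto
  also have "\<dots> = (\<Sum>B\<in>?S. p ^ card F * (p ^ card B * (1 - p) ^ card (N - B)))"
  proof (intro sum.cong refl)
    fix B assume B: "B \<in> ?S"
    have "card (F \<union> B) = card F + card B"
      using B disj fN by (intro card_Un_disjoint) (auto intro: finite_subset)
    moreover have "?P {E. F \<union> B \<subseteq> E \<and> E \<inter> (N - B) = {}} = p ^ card (F \<union> B) * (1 - p) ^ card (N - B)"
      using B N F disj by (intro prob_random_subgraph_cylinder fin p) auto
    ultimately show "?P {E. F \<union> B \<subseteq> E \<and> E \<inter> (N - B) = {}} =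
        p ^ card F * (p ^ card B * (1 - p) ^ card (N - B))" by (simp add: power_add)
  qed
  also have "\<dots> \<le> (\<Sum>B\<in>?S. p ^ card F * ((1 / t) ^ m * ((t * p) ^ card B * (1 - p) ^ card (N - B))))"
  proof (intro sum_mono mult_left_mono)
    fix B assume B: "B \<in> ?S"
    have "(1::real) \<le> (1 / t) ^ (m - card B)" using t by (intro one_le_power) auto
    also have "\<dots> = (1 / t) ^ m * t ^ card B"
      using B t by (simp add: power_diff power_one_over field_simps)
    finally have "p ^ card B * 1 \<le> p ^ card B * ((1 / t) ^ m * t ^ card B)"
      using p by (intro mult_left_mono) auto
    then have "p ^ card B \<le> (1 / t) ^ m * (t * p) ^ card B"
      by (simp add: power_mult_distrib mult_ac)
    then have "p ^ card B * (1 - p) ^ card (N - B) \<le> (1 / t) ^ m * (t * p) ^ card B * (1 - p) ^ card (N - B)"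
      using p by (intro mult_right_mono) auto
    then show "p ^ card B * (1 - p) ^ card (N - B) \<le> (1 / t) ^ m * ((t * p) ^ card B * (1 - p) ^ card (N - B))"
      by (simp add: mult.assoc)
  qed (use p in auto)
  also have "\<dots> \<le> (\<Sum>B\<in>Pow N. p ^ card F * ((1 / t) ^ m * ((t * p) ^ card B * (1 - p) ^ card (N - B))))"
    using p t fN by (intro sum_mono2) auto
  also have "\<dots> = p ^ card F * (1 / t) ^ m * (t * p + (1 - p)) ^ card N"
    by (simp add: sum_distrib_left[symmetric] sum_Pow_power[OF fN(1)] mult.assoc)
  finally show ?thesis .
qed

text \<open>
  The cells of \<open>T\<close> and their images form disjoint pairs, each of which is wholly present or wholly absent.
  If \<open>B\<close> is the set of present cells of \<open>T\<close>, the probability has the factor \<open>p\<^bsup>2 |B|\<^esup>\<close>; one half of it is bounded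
  by \<open>p\<^sup>m\<close>, and the other half is summed over all \<open>B\<close>.
\<close>

lemma prob_invariant_many_edges:
  assumes fin: "finite I" "finite J" and p: "0 \<le> p" "p \<le> 1"
    and T: "T \<subseteq> I \<times> J" "\<phi> ` T \<subseteq> I \<times> J" and inj: "inj_on \<phi> T" and disj: "\<phi> ` T \<inter> T = {}"
  shows "measure_pmf.prob (random_subgraph I J p)
      {E. (\<forall>e\<in>T. \<phi> e \<in> E \<longleftrightarrow> e \<in> E) \<and> m \<le> card (E \<inter> T)} \<le> p ^ m * (p + (1 - p)\<^sup>2) ^ card T"
proof -
  let ?P = "measure_pmf.prob (random_subgraph I J p)"
  let ?S = "{B \<in> Pow T. m \<le> card B}"
  have fT: "finite T" using T fin by (auto intro: finite_subset)
  have "?P {E. (\<forall>e\<in>T. \<phi> e \<in> E \<longleftrightarrow> e \<in> E) \<and> m \<le> card (E \<inter> T)} \<le>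
      ?P (\<Union>B\<in>?S. {E. B \<union> \<phi> ` B \<subseteq> E \<and> E \<inter> ((T - B) \<union> \<phi> ` (T - B)) = {}})"
  proof (intro measure_pmf.finite_measure_mono subsetI)
    fix E assume "E \<in> {E. (\<forall>e\<in>T. \<phi> e \<in> E \<longleftrightarrow> e \<in> E) \<and> m \<le> card (E \<inter> T)}"
    then have inv: "\<forall>e\<in>T. \<phi> e \<in> E \<longleftrightarrow> e \<in> E" and m: "E \<inter> T \<in> ?S" by auto
    have "(E \<inter> T) \<union> \<phi> ` (E \<inter> T) \<subseteq> E" using inv by blast
    moreover have "E \<inter> ((T - E \<inter> T) \<union> \<phi> ` (T - E \<inter> T)) = {}" using inv by blast
    ultimately show "E \<in> (\<Union>B\<in>?S. {E. B \<union> \<phi> ` B \<subseteq> E \<and> E \<inter> ((T - B) \<union> \<phi> ` (T - B)) = {}})"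
      using UN_I[OF m, of E "\<lambda>B. {E. B \<union> \<phi> ` B \<subseteq> E \<and> E \<inter> ((T - B) \<union> \<phi> ` (T - B)) = {}}"]
      by (simp only: mem_Collect_eq)
  qed simp
  also have "\<dots> \<le> (\<Sum>B\<in>?S. ?P {E. B \<union> \<phi> ` B \<subseteq> E \<and> E \<inter> ((T - B) \<union> \<phi> ` (T - B)) = {}})"
    using fT by (intro measure_UNION_le) auto
  also have "\<dots> = (\<Sum>B\<in>?S. p ^ card B * p ^ card B * ((1 - p)\<^sup>2) ^ card (T - B))"
  proof (intro sum.cong refl)
    fix B assume B: "B \<in> ?S"
    have c: "card (C \<union> \<phi> ` C) = 2 * card C" if "C \<subseteq> T" for C
    proof -
      have "card (C \<union> \<phi> ` C) = card C + card (\<phi> ` C)"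
        using that fT disj by (intro card_Un_disjoint) (auto intro: finite_subset)
      also have "card (\<phi> ` C) = card C" using inj that by (intro card_image) (rule inj_on_subset)
      finally show ?thesis by simp
    qed
    have d: "\<phi> ` B \<inter> \<phi> ` (T - B) = {}"
      using inj B inj_on_image_Int[OF inj, of B "T - B"] by auto
    have "?P {E. B \<union> \<phi> ` B \<subseteq> E \<and> E \<inter> ((T - B) \<union> \<phi> ` (T - B)) = {}} =
        p ^ card (B \<union> \<phi> ` B) * (1 - p) ^ card ((T - B) \<union> \<phi> ` (T - B))"
      using B T disj d by (intro prob_random_subgraph_cylinder fin p) blast+
    also have "\<dots> = p ^ card B * p ^ card B * ((1 - p)\<^sup>2) ^ card (T - B)"
      using B c[of B] c[of "T - B"] by (simp add: power_mult power2_eq_square power_mult_distrib)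
    finally show "?P {E. B \<union> \<phi> ` B \<subseteq> E \<and> E \<inter> ((T - B) \<union> \<phi> ` (T - B)) = {}} =
        p ^ card B * p ^ card B * ((1 - p)\<^sup>2) ^ card (T - B)" .
  qed
  also have "\<dots> \<le> (\<Sum>B\<in>?S. p ^ m * p ^ card B * ((1 - p)\<^sup>2) ^ card (T - B))"
    using p by (intro sum_mono mult_right_mono power_decreasing) auto
  also have "\<dots> \<le> (\<Sum>B\<in>Pow T. p ^ m * p ^ card B * ((1 - p)\<^sup>2) ^ card (T - B))"
    using p fT by (intro sum_mono2) auto
  also have "\<dots> = p ^ m * (p + (1 - p)\<^sup>2) ^ card T"
    by (simp add: sum_distrib_left[symmetric] sum_Pow_power[OF fT] mult.assoc)
  finally show ?thesis .
qed

text \<open>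
  A maximal set \<open>T\<close> that is disjoint from its image meets \<open>{x, \<phi> x, \<phi> (\<phi> x)}\<close> for every \<open>x\<close>, so that \<open>T\<close> and its image
  and preimage cover everything, and none of these three sets contains more elements of an invariant set
  than \<open>T\<close> does.  This replaces an orbit decomposition.
\<close>

lemma third_of_orbits:
  assumes fin: "finite N" and im: "\<phi> ` N = N" and nofix: "\<And>x. x \<in> N \<Longrightarrow> \<phi> x \<noteq> x"
  obtains T where "T \<subseteq> N" "\<phi> ` T \<inter> T = {}"
    "\<And>A. A \<subseteq> N \<Longrightarrow> (\<And>x. x \<in> N \<Longrightarrow> \<phi> x \<in> A \<longleftrightarrow> x \<in> A) \<Longrightarrow> card A \<le> 3 * card (A \<inter> T)"
proof -
  have inj: "inj_on \<phi> N" using fin im by (simp add: eq_card_imp_inj_on)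
  let ?\<T> = "{T. T \<subseteq> N \<and> \<phi> ` T \<inter> T = {}}"
  have "finite ?\<T>" using fin by simp
  moreover have "{} \<in> ?\<T>" by simp
  ultimately obtain T where T: "T \<in> ?\<T>" and max: "\<forall>T'\<in>?\<T>. T \<subseteq> T' \<longrightarrow> T = T'"
    using finite_has_maximal[of ?\<T>] by (metis (lifting) empty_iff)
  have fT: "finite T" using T fin by (auto intro: finite_subset)
  have cover: "x \<in> \<phi> ` T \<or> \<phi> x \<in> T" if x: "x \<in> N" "x \<notin> T" for x
  proof (rule ccontr)
    assume "\<not> ?thesis"
    then have "insert x T \<in> ?\<T>" using T x nofix by auto
    then have "T = insert x T" using max by blast
    then show False using x by blast
  qed
  show ?thesis
  proof (rule that[of T])
    show "T \<subseteq> N" "\<phi> ` T \<inter> T = {}" using T by auto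
    fix A assume A: "A \<subseteq> N" and inv: "\<And>x. x \<in> N \<Longrightarrow> \<phi> x \<in> A \<longleftrightarrow> x \<in> A"
    let ?B = "A \<inter> T"
    let ?C = "{x \<in> N. \<phi> x \<in> ?B}"
    have "A \<subseteq> ?B \<union> \<phi> ` ?B \<union> ?C" using A cover inv T by blast
    then have "card A \<le> card (?B \<union> \<phi> ` ?B \<union> ?C)" using fT fin by (intro card_mono) auto
    also have "\<dots> \<le> card ?B + card (\<phi> ` ?B) + card ?C"
      by (meson add_le_mono card_Un_le le_refl le_trans)
    also have "card (\<phi> ` ?B) \<le> card ?B" using fT by (intro card_image_le) auto
    also have "card ?C = card (\<phi> ` ?C)"
      using inj by (intro card_image[symmetric]) (auto intro: inj_on_subset)
    also have "card (\<phi> ` ?C) \<le> card ?B" using fT by (intro card_mono) auto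
    finally show "card A \<le> 3 * card ?B" by simp
  qed
qed

lemma card_moved_cells:
  assumes fin: "finite I" "finite J" and s: "\<sigma> permutes I" and r: "\<rho> permutes J" and n: "card I = n" "card J = n"
  shows "(card {i. \<sigma> i \<noteq> i} + card {j. \<rho> j \<noteq> j}) * n \<le> 2 * card (moved_cells I J \<sigma> \<rho>)"
proof -
  let ?D = "{i. \<sigma> i \<noteq> i}" let ?K = "{j. \<rho> j \<noteq> j}"
  have D: "?D \<subseteq> I" and K: "?K \<subseteq> J" using permutes_not_in[OF s] permutes_not_in[OF r] by blast+
  have cD: "?D \<times> J \<subseteq> moved_cells I J \<sigma> \<rho>" "I \<times> ?K \<subseteq> moved_cells I J \<sigma> \<rho>"
    using D K by (auto simp: moved_cells_def)
  have "finite (moved_cells I J \<sigma> \<rho>)"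
    by (rule finite_subset[of _ "I \<times> J"]) (use fin in \<open>auto simp: moved_cells_def\<close>)
  from card_mono[OF this cD(1)] card_mono[OF this cD(2)]
  show ?thesis using n by (simp add: card_cartesian_product algebra_simps)
qed

text \<open>
  At least a third of the moved cells, and of the edges in them, lie in a suitable set \<open>T\<close> that is
  disjoint from its image: this gives the factor \<open>p\<^bsup>2 m\<^esup>\<close> from the
  edges, and, as there are at least \<open>m n / 2\<close> moved cells, the exponential factor from the agreement of
  the cells with their images.  The latter is needed when \<open>p\<close> is not small.
\<close>

lemma prob_automorphism_many_moved_edges:
  assumes fin: "finite I" "finite J" and n: "card I = n" "card J = n" and p: "0 \<le> p" "p \<le> 1 / 2"
    and s: "\<sigma> permutes I" and r: "\<rho> permutes J"
  defines "m \<equiv> card {i. \<sigma> i \<noteq> i} + card {j. \<rho> j \<noteq> j}"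
  shows "measure_pmf.prob (random_subgraph I J p)
      {E. automorphism I J E \<sigma> \<rho> \<and> 6 * m \<le> card (E \<inter> moved_cells I J \<sigma> \<rho>)} \<le>
    (p\<^sup>2 * exp (- (p * n / 12))) ^ m"
proof -
  let ?N = "moved_cells I J \<sigma> \<rho>"
  let ?\<phi> = "map_prod \<sigma> \<rho>"
  have finN: "finite ?N"
    by (rule finite_subset[of _ "I \<times> J"]) (use fin in \<open>auto simp: moved_cells_def\<close>)
  have nofix: "?\<phi> x \<noteq> x" if "x \<in> ?N" for x using that by (auto simp: moved_cells_def)
  have inj: "inj ?\<phi>" using s r by (intro prod.inj_map) (auto intro: permutes_inj)
  have "?\<phi> x \<in> ?N" if "x \<in> ?N" for x
    using that permutes_in_image[OF s] permutes_in_image[OF r] permutes_inj[OF s] permutes_inj[OF r]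
    by (auto simp: moved_cells_def dest: injD)
  then have im: "?\<phi> ` ?N = ?N"
    using inj finN by (intro endo_inj_surj) (auto intro: inj_on_subset)
  obtain T where T: "T \<subseteq> ?N" "?\<phi> ` T \<inter> T = {}"
    and T3: "\<And>A. A \<subseteq> ?N \<Longrightarrow> (\<And>x. x \<in> ?N \<Longrightarrow> ?\<phi> x \<in> A \<longleftrightarrow> x \<in> A) \<Longrightarrow> card A \<le> 3 * card (A \<inter> T)"
    using third_of_orbits[OF finN im nofix] by blast
  have inN: "?\<phi> x \<in> ?N" if "x \<in> ?N" for x using im that by blast
  have "card ?N \<le> 3 * card (?N \<inter> T)" using inN by (intro T3) auto
  then have cT: "card ?N \<le> 3 * card T" using T by (simp add: Int_absorb1)
  have "measure_pmf.prob (random_subgraph I J p) {E. automorphism I J E \<sigma> \<rho> \<and> 6 * m \<le> card (E \<inter> ?N)} \<le>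
    measure_pmf.prob (random_subgraph I J p) {E. (\<forall>e\<in>T. ?\<phi> e \<in> E \<longleftrightarrow> e \<in> E) \<and> 2 * m \<le> card (E \<inter> T)}"
  proof (intro measure_pmf.finite_measure_mono subsetI CollectI)
    fix E assume "E \<in> {E. automorphism I J E \<sigma> \<rho> \<and> 6 * m \<le> card (E \<inter> ?N)}"
    then have aut: "automorphism I J E \<sigma> \<rho>" and c: "6 * m \<le> card (E \<inter> ?N)" by auto
    have inv: "?\<phi> e \<in> E \<longleftrightarrow> e \<in> E" for e using aut by (cases e) (auto simp: automorphism_def)
    have "card (E \<inter> ?N) \<le> 3 * card (E \<inter> ?N \<inter> T)" using inv inN by (intro T3) auto
    moreover have "E \<inter> ?N \<inter> T = E \<inter> T" using T by auto
    ultimately have "2 * m \<le> card (E \<inter> T)" using c by simp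
    then show "(\<forall>e\<in>T. ?\<phi> e \<in> E \<longleftrightarrow> e \<in> E) \<and> 2 * m \<le> card (E \<inter> T)" using inv by blast
  qed simp
  also have "\<dots> \<le> p ^ (2 * m) * (p + (1 - p)\<^sup>2) ^ card T"
  proof (rule prob_invariant_many_edges[OF fin])
    have sub: "?N \<subseteq> I \<times> J" by (auto simp: moved_cells_def)
    show "T \<subseteq> I \<times> J" using T(1) sub by (rule order.trans)
    have "?\<phi> ` T \<subseteq> ?N" using image_mono[OF T(1), of ?\<phi>] im by simp
    then show "?\<phi> ` T \<subseteq> I \<times> J" using sub by (rule order.trans)
    show "inj_on ?\<phi> T" using inj by (rule inj_on_subset) simp
  qed (use p T in auto)
  also have "\<dots> \<le> p ^ (2 * m) * exp (- (p * n / 12)) ^ m"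
  proof (rule mult_left_mono)
    have "p * p \<le> p * (1 / 2)" using p by (intro mult_left_mono)
    then have "p + (1 - p)\<^sup>2 \<le> 1 + (- p / 2)" by (simp add: power2_eq_square algebra_simps)
    also have "\<dots> \<le> exp (- p / 2)" by (rule exp_ge_add_one_self)
    finally have "(p + (1 - p)\<^sup>2) ^ card T \<le> exp (- p / 2) ^ card T"
      using p by (intro power_mono) auto
    also have "\<dots> = exp (- (p / 2 * card T))" by (simp add: exp_of_nat_mult[symmetric] mult_ac)
    also have "\<dots> \<le> exp (- (p / 2 * (m * n / 6)))"
    proof -
      have "m * n \<le> 2 * card ?N" unfolding m_def by (rule card_moved_cells[OF fin s r n])
      then have "m * n \<le> 6 * card T" using cT by linarith
      then have "real (m * n) \<le> real (6 * card T)" by (rule of_nat_mono)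
      then have "p / 2 * (m * n / 6) \<le> p / 2 * card T" using p by (intro mult_left_mono) auto
      then show ?thesis by simp
    qed
    also have "\<dots> = exp (- (p * n / 12)) ^ m" by (simp add: exp_of_nat_mult[symmetric] mult_ac)
    finally show "(p + (1 - p)\<^sup>2) ^ card T \<le> exp (- (p * n / 12)) ^ m" .
  qed (use p in auto)
  also have "\<dots> = (p\<^sup>2 * exp (- (p * n / 12))) ^ m" by (simp add: power_mult_distrib power_mult)
  finally show ?thesis .
qed

lemma card_permutations_moving:
  assumes "finite I" "card I = n"
  shows "card {\<sigma>. \<sigma> permutes I \<and> card {i. \<sigma> i \<noteq> i} = a} \<le> n ^ a"
proof -
  let ?\<D> = "{D. D \<subseteq> I \<and> card D = a}"
  have f: "finite ?\<D>" by (rule finite_subset[of _ "Pow I"]) (use assms(1) in auto)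
  have fp: "finite {\<sigma>. \<sigma> permutes D}" if "D \<in> ?\<D>" for D
    using that assms by (intro finite_permutations) (auto intro: finite_subset)
  have "{\<sigma>. \<sigma> permutes I \<and> card {i. \<sigma> i \<noteq> i} = a} \<subseteq> (\<Union>D\<in>?\<D>. {\<sigma>. \<sigma> permutes D})"
  proof
    fix \<sigma> assume "\<sigma> \<in> {\<sigma>. \<sigma> permutes I \<and> card {i. \<sigma> i \<noteq> i} = a}"
    then have s: "\<sigma> permutes I" and a: "card {i. \<sigma> i \<noteq> i} = a" by auto
    have "{i. \<sigma> i \<noteq> i} \<subseteq> I" using permutes_not_in[OF s] by blast
    moreover have "\<sigma> permutes {i. \<sigma> i \<noteq> i}" by (rule permutes_superset[OF s]) auto
    ultimately show "\<sigma> \<in> (\<Union>D\<in>?\<D>. {\<sigma>. \<sigma> permutes D})" using a by blast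
  qed
  then have "card {\<sigma>. \<sigma> permutes I \<and> card {i. \<sigma> i \<noteq> i} = a} \<le> card (\<Union>D\<in>?\<D>. {\<sigma>. \<sigma> permutes D})"
    using f fp by (intro card_mono) auto
  also have "\<dots> \<le> (\<Sum>D\<in>?\<D>. card {\<sigma>. \<sigma> permutes D})" using f by (rule card_UN_le)
  also have "\<dots> = (\<Sum>D\<in>?\<D>. fact a)"
    using assms by (intro sum.cong refl card_permutations) (auto intro: finite_subset)
  also have "\<dots> = (n choose a) * fact a" using n_subsets[OF assms(1)] assms(2) by simp
  also have "\<dots> \<le> n ^ a" by (rule binomial_fact_pow)
  finally show ?thesis .
qed

text \<open>
  At most \<open>n\<^sup>a\<close> permutations move exactly \<open>a\<close> points, which leaves a geometric series.
\<close>

lemma sum_permutations_le: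
  fixes y :: real
  assumes fin: "finite I" "card I = n" and y: "0 \<le> y" and z: "n * y \<le> 1 / 2"
  shows "(\<Sum>\<sigma> | \<sigma> permutes I \<and> \<sigma> \<noteq> id. y ^ card {i. \<sigma> i \<noteq> i}) \<le> 2 * (n * y)"
proof -
  let ?P = "{\<sigma>. \<sigma> permutes I \<and> \<sigma> \<noteq> id}"
  let ?z = "n * y"
  have fP: "finite ?P" using finite_permutations[OF fin(1)] by simp
  have rng: "card {i. \<sigma> i \<noteq> i} \<in> {1..n}" if "\<sigma> \<in> ?P" for \<sigma>
  proof -
    have "{i. \<sigma> i \<noteq> i} \<subseteq> I" using that permutes_not_in[of \<sigma> I] by blast
    moreover have "{i. \<sigma> i \<noteq> i} \<noteq> {}" using that by auto
    ultimately show ?thesis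
      using fin card_mono[of I "{i. \<sigma> i \<noteq> i}"] by (auto simp: Suc_le_eq card_gt_0_iff intro: finite_subset)
  qed
  have "(\<Sum>\<sigma>\<in>?P. y ^ card {i. \<sigma> i \<noteq> i}) =
      (\<Sum>a\<in>{1..n}. \<Sum>\<sigma>\<in>{\<sigma> \<in> ?P. card {i. \<sigma> i \<noteq> i} = a}. y ^ card {i. \<sigma> i \<noteq> i})"
    using fP rng by (intro sum.group[symmetric]) auto
  also have "\<dots> \<le> (\<Sum>a\<in>{1..n}. ?z ^ a)"
  proof (intro sum_mono)
    fix a
    have "card {\<sigma> \<in> ?P. card {i. \<sigma> i \<noteq> i} = a} \<le> card {\<sigma>. \<sigma> permutes I \<and> card {i. \<sigma> i \<noteq> i} = a}"
      using finite_permutations[OF fin(1)] by (intro card_mono) auto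
    also have "\<dots> \<le> n ^ a" by (rule card_permutations_moving[OF fin])
    finally have "real (card {\<sigma> \<in> ?P. card {i. \<sigma> i \<noteq> i} = a}) \<le> real (n ^ a)" by (rule of_nat_mono)
    then have "real (card {\<sigma> \<in> ?P. card {i. \<sigma> i \<noteq> i} = a}) * y ^ a \<le> real (n ^ a) * y ^ a"
      using y by (intro mult_right_mono) auto
    then show "(\<Sum>\<sigma>\<in>{\<sigma> \<in> ?P. card {i. \<sigma> i \<noteq> i} = a}. y ^ card {i. \<sigma> i \<noteq> i}) \<le> ?z ^ a"
      by (simp add: power_mult_distrib)
  qed
  also have "\<dots> \<le> (\<Sum>a\<in>{1..n}. ?z * (1 / 2) ^ (a - 1))"
  proof (intro sum_mono)
    fix a assume a: "a \<in> {1..n}"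
    have "?z ^ a = ?z * ?z ^ (a - 1)" using a by (cases a) auto
    also have "\<dots> \<le> ?z * (1 / 2) ^ (a - 1)" using y z by (intro mult_left_mono power_mono) auto
    finally show "?z ^ a \<le> ?z * (1 / 2) ^ (a - 1)" .
  qed
  also have "\<dots> = ?z * (\<Sum>a<n. (1 / 2) ^ a)"
    unfolding sum_distrib_left[symmetric]
    by (rule arg_cong[of _ _ "(*) ?z"], rule sum.reindex_bij_witness[of _ Suc "\<lambda>a. a - 1"]) auto
  also have "\<dots> \<le> ?z * 2"
  proof (rule mult_left_mono)
    have "(\<Sum>a<n. (1 / 2 :: real) ^ a) \<le> (\<Sum>a. (1 / 2) ^ a)"
      by (intro sum_le_suminf summable_geometric) auto
    also have "\<dots> = 2" using suminf_geometric[of "1 / 2 :: real"] by simp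
    finally show "(\<Sum>a<n. (1 / 2 :: real) ^ a) \<le> 2" .
  qed (use y in auto)
  finally show ?thesis by simp
qed

lemma prob_some_automorphism_many_moved_edges:
  assumes fin: "finite I" "finite J" and n: "card I = n" "card J = n" and p: "0 \<le> p" "p \<le> 1 / 2"
    and z: "n * (p\<^sup>2 * exp (- (p * n / 12))) \<le> 1 / 2"
  shows "measure_pmf.prob (random_subgraph I J p)
      {E. \<exists>\<sigma> \<rho>. automorphism I J E \<sigma> \<rho> \<and> \<sigma> \<noteq> id \<and> \<rho> \<noteq> id \<and>
        6 * (card {i. \<sigma> i \<noteq> i} + card {j. \<rho> j \<noteq> j}) \<le> card (E \<inter> moved_cells I J \<sigma> \<rho>)} \<le>
    4 * (n * (p\<^sup>2 * exp (- (p * n / 12))))\<^sup>2"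
proof -
  let ?M = "random_subgraph I J p"
  let ?P = "{\<sigma>. \<sigma> permutes I \<and> \<sigma> \<noteq> id}" and ?R = "{\<rho>. \<rho> permutes J \<and> \<rho> \<noteq> id}"
  let ?y = "p\<^sup>2 * exp (- (p * n / 12))"
  let ?m = "\<lambda>\<sigma> \<rho>. card {i. \<sigma> i \<noteq> i} + card {j. \<rho> j \<noteq> j}"
  let ?B = "\<lambda>(\<sigma>, \<rho>). {E. automorphism I J E \<sigma> \<rho> \<and> 6 * ?m \<sigma> \<rho> \<le> card (E \<inter> moved_cells I J \<sigma> \<rho>)}"
  have fPR: "finite ?P" "finite ?R"
    using finite_permutations[OF fin(1)] finite_permutations[OF fin(2)] by simp_all
  have y: "0 \<le> ?y" by simp
  have "measure_pmf.prob ?M {E. \<exists>\<sigma> \<rho>. automorphism I J E \<sigma> \<rho> \<and> \<sigma> \<noteq> id \<and> \<rho> \<noteq> id \<and>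
        6 * ?m \<sigma> \<rho> \<le> card (E \<inter> moved_cells I J \<sigma> \<rho>)} \<le> measure_pmf.prob ?M (\<Union>x\<in>?P \<times> ?R. ?B x)"
  proof (intro measure_pmf.finite_measure_mono subsetI)
    fix E assume "E \<in> {E. \<exists>\<sigma> \<rho>. automorphism I J E \<sigma> \<rho> \<and> \<sigma> \<noteq> id \<and> \<rho> \<noteq> id \<and>
        6 * ?m \<sigma> \<rho> \<le> card (E \<inter> moved_cells I J \<sigma> \<rho>)}"
    then obtain \<sigma> \<rho> where h: "automorphism I J E \<sigma> \<rho>" "\<sigma> \<noteq> id" "\<rho> \<noteq> id"
        "6 * ?m \<sigma> \<rho> \<le> card (E \<inter> moved_cells I J \<sigma> \<rho>)" by blast
    then have "(\<sigma>, \<rho>) \<in> ?P \<times> ?R" by (simp add: automorphism_def)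
    then show "E \<in> (\<Union>x\<in>?P \<times> ?R. ?B x)" using h by (intro UN_I[of "(\<sigma>, \<rho>)"]) simp_all
  qed simp
  also have "\<dots> \<le> (\<Sum>x\<in>?P \<times> ?R. measure_pmf.prob ?M (?B x))"
    using fPR by (intro measure_UNION_le) auto
  also have "\<dots> \<le> (\<Sum>(\<sigma>, \<rho>)\<in>?P \<times> ?R. ?y ^ card {i. \<sigma> i \<noteq> i} * ?y ^ card {j. \<rho> j \<noteq> j})"
    using prob_automorphism_many_moved_edges[OF fin n p]
    by (intro sum_mono) (auto simp: power_add[symmetric])
  also have "\<dots> = (\<Sum>\<sigma>\<in>?P. ?y ^ card {i. \<sigma> i \<noteq> i}) * (\<Sum>\<rho>\<in>?R. ?y ^ card {j. \<rho> j \<noteq> j})"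
    by (simp add: sum_product sum.cartesian_product)
  also have "\<dots> \<le> (2 * (n * ?y)) * (2 * (n * ?y))"
    using sum_permutations_le[OF fin(1) n(1) y z] sum_permutations_le[OF fin(2) n(2) y z]
    by (intro mult_mono sum_nonneg) auto
  finally show ?thesis by (simp add: power2_eq_square)
qed

section \<open>Three low vertices on a small tree\<close>

lemma two_edge_configsD:
  assumes "(F, D, K) \<in> two_edge_configs I J"
  shows "F \<subseteq> I \<times> J" "D \<subseteq> I" "K \<subseteq> J" "card F = 2" "card D + card K = 3"
  using assms unfolding two_edge_configs_def by auto

lemma three_edge_configsD:
  assumes "(F, D, K) \<in> three_edge_configs I J"
  shows "F \<subseteq> I \<times> J" "D \<subseteq> I" "K \<subseteq> J" "card F = 3" "card D + card K = 3"
  using assms unfolding three_edge_configs_def by auto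

lemma card_two_edge_configs:
  assumes fin: "finite I" "finite J" and n: "card I = n" "card J = n"
  shows "finite (two_edge_configs I J)" "card (two_edge_configs I J) \<le> 2 * n ^ 3"
proof -
  have c: "finite A \<and> card (f ` A) \<le> m" if "A \<subseteq> B" "finite B" "card B = m"
    for f :: "'c \<Rightarrow> 'd" and A B m
    using that by (metis card_image_le card_mono finite_subset le_trans)
  have 1: "finite {(i, i', j) \<in> I \<times> I \<times> J. i \<noteq> i'} \<and>
      card (f ` {(i, i', j) \<in> I \<times> I \<times> J. i \<noteq> i'}) \<le> n ^ 3" for f :: "_ \<Rightarrow> 'c"
    using fin n by (intro c[of _ "I \<times> I \<times> J"]) (auto simp: card_cartesian_product power3_eq_cube)
  have 2: "finite {(i, j, j') \<in> I \<times> J \<times> J. j \<noteq> j'} \<and>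
      card (f ` {(i, j, j') \<in> I \<times> J \<times> J. j \<noteq> j'}) \<le> n ^ 3" for f :: "_ \<Rightarrow> 'c"
    using fin n by (intro c[of _ "I \<times> J \<times> J"]) (auto simp: card_cartesian_product power3_eq_cube)
  show "finite (two_edge_configs I J)"
    unfolding two_edge_configs_def using 1 2 by blast
  show "card (two_edge_configs I J) \<le> 2 * n ^ 3"
    unfolding two_edge_configs_def mult_2 by (intro order.trans[OF card_Un_le] add_mono conjunct2[OF 1] conjunct2[OF 2])
qed

lemma card_three_edge_configs:
  assumes fin: "finite I" "finite J" and n: "card I = n" "card J = n"
  shows "finite (three_edge_configs I J)" "card (three_edge_configs I J) \<le> 4 * n ^ 4"
proof -
  have c: "finite A \<and> card (f ` A) \<le> m" if "A \<subseteq> B" "finite B" "card B = m"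
    for f :: "'c \<Rightarrow> 'd" and A B m
    using that by (metis card_image_le card_mono finite_subset le_trans)
  have n4: "n * (n * (n * n)) = n ^ 4" by (simp add: power4_eq_xxxx)
  have 1: "finite {(i, i', j, j') \<in> I \<times> I \<times> J \<times> J. i \<noteq> i' \<and> j \<noteq> j'} \<and>
      card (f ` {(i, i', j, j') \<in> I \<times> I \<times> J \<times> J. i \<noteq> i' \<and> j \<noteq> j'}) \<le> n ^ 4" for f :: "_ \<Rightarrow> 'c"
    using fin n n4 by (intro c[of _ "I \<times> I \<times> J \<times> J"]) (auto simp: card_cartesian_product)
  have 2: "finite {(i, i', i'', j) \<in> I \<times> I \<times> I \<times> J. i \<noteq> i' \<and> i' \<noteq> i'' \<and> i \<noteq> i''} \<and>
      card (f ` {(i, i', i'', j) \<in> I \<times> I \<times> I \<times> J. i \<noteq> i' \<and> i' \<noteq> i'' \<and> i \<noteq> i''}) \<le> n ^ 4"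
    for f :: "_ \<Rightarrow> 'c"
    using fin n n4 by (intro c[of _ "I \<times> I \<times> I \<times> J"]) (auto simp: card_cartesian_product)
  have 3: "finite {(i, j, j', j'') \<in> I \<times> J \<times> J \<times> J. j \<noteq> j' \<and> j' \<noteq> j'' \<and> j \<noteq> j''} \<and>
      card (f ` {(i, j, j', j'') \<in> I \<times> J \<times> J \<times> J. j \<noteq> j' \<and> j' \<noteq> j'' \<and> j \<noteq> j''}) \<le> n ^ 4"
    for f :: "_ \<Rightarrow> 'c"
    using fin n n4 by (intro c[of _ "I \<times> J \<times> J \<times> J"]) (auto simp: card_cartesian_product)
  show "finite (three_edge_configs I J)"
    unfolding three_edge_configs_def using 1 2 3 by blast
  have "card (three_edge_configs I J) \<le> n ^ 4 + n ^ 4 + n ^ 4 + n ^ 4"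
    unfolding three_edge_configs_def
    by (intro order.trans[OF card_Un_le] add_mono conjunct2[OF 1] conjunct2[OF 2] conjunct2[OF 3])
  then show "card (three_edge_configs I J) \<le> 4 * n ^ 4" by simp
qed

text \<open>
  The rows and columns of the three low vertices cover at least \<open>3 n - 2\<close> cells, at most three of which
  belong to the tree; the remaining ones contain at most 360 edges.  Weighting each edge by \<open>1 / 10\<close> costs a factor \<open>10\<^bsup>360\<^esup>\<close> and leaves nine
  tenths of the exponent \<open>3 n p\<close>.
\<close>

lemma prob_low_config:
  assumes fin: "finite I" "finite J" and n: "card I = n" "card J = n" and p: "0 \<le> p" "p \<le> 1 / 2"
    and F: "F \<subseteq> I \<times> J" "card F \<le> 3" and D: "D \<subseteq> I" and K: "K \<subseteq> J" and DK: "card D + card K = 3"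
  shows "measure_pmf.prob (random_subgraph I J p) {E. low_config E (F, D, K)} \<le>
    10 ^ 360 * exp 3 * p ^ card F * exp (- (27 / 10 * (p * n)))"
proof -
  let ?P = "measure_pmf.prob (random_subgraph I J p)"
  define C where "C = D \<times> J \<union> I \<times> K"
  define N where "N = C - F"
  have fDK: "finite D" "finite K" using D K fin finite_subset by blast+
  have fC: "finite C" using fDK fin by (simp add: C_def)
  have cDK: "card D * card K \<le> 2"
  proof -
    have "card D \<in> {0, 1, 2, 3}" using DK by auto
    then show ?thesis using DK by auto
  qed
  have "card D * n + n * card K = card C + card (D \<times> J \<inter> I \<times> K)"
    using card_Un_Int[of "D \<times> J" "I \<times> K"] fDK fin n by (simp add: C_def card_cartesian_product)
  also have "D \<times> J \<inter> I \<times> K = D \<times> K" using D K by auto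
  also have "card D * n + n * card K = 3 * n" using DK by (metis mult.commute distrib_right)
  finally have "3 * n \<le> card C + 2" using cDK by (simp add: card_cartesian_product)
  moreover have "card C \<le> card N + card F"
    using fC F(1) fin card_Un_le[of N F] card_mono[of "N \<union> F" C] finite_subset[OF F(1)]
    by (fastforce simp: N_def)
  ultimately have cN: "3 * n \<le> card N + 5" using F(2) by simp
  have "?P {E. low_config E (F, D, K)} \<le> ?P {E. F \<subseteq> E \<and> card (E \<inter> N) \<le> 360}"
  proof (rule prob_random_subgraph_mono)
    fix E assume E: "E \<subseteq> I \<times> J" and low: "low_config E (F, D, K)"
    have fE: "finite E" using E fin finite_subset by blast
    have "E \<inter> N \<subseteq> (SIGMA i:D. E `` {i}) \<union> (SIGMA j:K. E\<inverse> `` {j})\<inverse>"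
      by (auto simp: N_def C_def)
    then have "card (E \<inter> N) \<le> card ((SIGMA i:D. E `` {i}) \<union> (SIGMA j:K. E\<inverse> `` {j})\<inverse>)"
      using fE fDK by (intro card_mono) (auto intro!: finite_SigmaI finite_Image)
    also have "\<dots> \<le> card (SIGMA i:D. E `` {i}) + card (SIGMA j:K. E\<inverse> `` {j})"
      using card_Un_le[of "SIGMA i:D. E `` {i}" "(SIGMA j:K. E\<inverse> `` {j})\<inverse>"] by simp
    also have "\<dots> = (\<Sum>i\<in>D. card (E `` {i})) + (\<Sum>j\<in>K. card (E\<inverse> `` {j}))"
      using fE fDK by (intro arg_cong2[of _ _ _ _ "(+)"] card_SigmaI) (auto intro!: finite_Image)
    also have "\<dots> \<le> (\<Sum>i\<in>D. 120) + (\<Sum>j\<in>K. 120)"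
      using low by (intro add_mono sum_mono) (auto simp: low_config_def less_imp_le)
    also have "\<dots> = 120 * (card D + card K)" by simp
    also have "\<dots> = 360" using DK by simp
    finally show "F \<subseteq> E \<and> card (E \<inter> N) \<le> 360" using low by (simp add: low_config_def)
  qed
  also have "\<dots> \<le> p ^ card F * (1 / (1 / 10)) ^ 360 * (1 / 10 * p + (1 - p)) ^ card N"
    using p F D K by (intro prob_few_edges fin) (auto simp: N_def C_def)
  also have "\<dots> \<le> p ^ card F * (1 / (1 / 10)) ^ 360 * (exp 3 * exp (- (27 / 10 * (p * n))))"
  proof (rule mult_left_mono)
    have "1 / 10 * p + (1 - p) = 1 + (- (9 / 10 * p))" by simp
    also have "\<dots> \<le> exp (- (9 / 10 * p))" by (rule exp_ge_add_one_self)
    finally have "(1 / 10 * p + (1 - p)) ^ card N \<le> exp (- (9 / 10 * p)) ^ card N"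
      using p by (intro power_mono) auto
    also have "\<dots> = exp (- (9 / 10 * (p * card N)))" by (simp add: exp_of_nat_mult[symmetric] mult_ac)
    also have "\<dots> \<le> exp (3 + - (27 / 10 * (p * n)))"
    proof -
      have "real (3 * n) \<le> real (card N + 5)" using cN by (rule of_nat_mono)
      then have "p * (3 * n) \<le> p * (card N + 5)" using p by (intro mult_left_mono) auto
      then show ?thesis using p by (simp add: algebra_simps)
    qed
    also have "\<dots> = exp 3 * exp (- (27 / 10 * (p * n)))" by (rule exp_add)
    finally show "(1 / 10 * p + (1 - p)) ^ card N \<le> exp 3 * exp (- (27 / 10 * (p * n)))" .
  qed (use p in simp)
  finally show ?thesis by (simp add: mult_ac)
qed

lemma prob_some_low_config:
  assumes fin: "finite I" "finite J" and n: "card I = n" "card J = n" and p: "0 \<le> p" "p \<le> 1 / 2"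
  shows "measure_pmf.prob (random_subgraph I J p)
      {E. \<exists>t \<in> two_edge_configs I J \<union> three_edge_configs I J. low_config E t} \<le>
    10 ^ 360 * exp 3 * n * (2 * (p * n) ^ 2 + 4 * (p * n) ^ 3) * exp (- (27 / 10 * (p * n)))"
proof -
  let ?M = "random_subgraph I J p"
  let ?c = "10 ^ 360 * exp (3::real)"
  let ?e = "exp (- (27 / 10 * (p * n)))"
  define c where "c = ?c"
  have c0: "0 \<le> c" by (simp add: c_def)
  note two = card_two_edge_configs[OF fin n] and three = card_three_edge_configs[OF fin n]
  have b2: "measure_pmf.prob ?M {E. low_config E t} \<le> c * p ^ 2 * ?e" if "t \<in> two_edge_configs I J" for t
  proof -
    obtain F D K where t: "t = (F, D, K)" by (cases t)
    note h = two_edge_configsD[OF that[unfolded t]]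
    show ?thesis using prob_low_config[OF fin n p h(1) _ h(2,3,5)] h(4) by (simp only: t c_def)
  qed
  have b3: "measure_pmf.prob ?M {E. low_config E t} \<le> c * p ^ 3 * ?e" if "t \<in> three_edge_configs I J" for t
  proof -
    obtain F D K where t: "t = (F, D, K)" by (cases t)
    note h = three_edge_configsD[OF that[unfolded t]]
    show ?thesis using prob_low_config[OF fin n p h(1) _ h(2,3,5)] h(4) by (simp only: t c_def)
  qed
  have "measure_pmf.prob ?M {E. \<exists>t \<in> two_edge_configs I J \<union> three_edge_configs I J. low_config E t} \<le>
      measure_pmf.prob ?M ((\<Union>t\<in>two_edge_configs I J. {E. low_config E t}) \<union> (\<Union>t\<in>three_edge_configs I J. {E. low_config E t}))"
    by (intro measure_pmf.finite_measure_mono) auto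
  also have "\<dots> \<le> measure_pmf.prob ?M (\<Union>t\<in>two_edge_configs I J. {E. low_config E t}) +
      measure_pmf.prob ?M (\<Union>t\<in>three_edge_configs I J. {E. low_config E t})"
    by (intro measure_Un_le) auto
  also have "\<dots> \<le> (\<Sum>t\<in>two_edge_configs I J. measure_pmf.prob ?M {E. low_config E t}) +
      (\<Sum>t\<in>three_edge_configs I J. measure_pmf.prob ?M {E. low_config E t})"
    using two three by (intro add_mono measure_UNION_le) auto
  also have "\<dots> \<le> (\<Sum>t\<in>two_edge_configs I J. c * p ^ 2 * ?e) + (\<Sum>t\<in>three_edge_configs I J. c * p ^ 3 * ?e)"
    using b2 b3 by (intro add_mono sum_mono) auto
  also have "\<dots> = card (two_edge_configs I J) * (c * p ^ 2 * ?e) + card (three_edge_configs I J) * (c * p ^ 3 * ?e)"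
    by simp
  also have "\<dots> \<le> real (2 * n ^ 3) * (c * p ^ 2 * ?e) + real (4 * n ^ 4) * (c * p ^ 3 * ?e)"
    using two(2) three(2) p c0 by (intro add_mono mult_right_mono of_nat_mono) auto
  also have "\<dots> = c * n * (2 * (p * n) ^ 2 + 4 * (p * n) ^ 3) * ?e"
    by (simp add: power_mult_distrib algebra_simps power2_eq_square power3_eq_cube power4_eq_xxxx)
  finally show ?thesis by (simp only: c_def)
qed

section \<open>Failure of reconstruction with at most one isolated edge\<close>

lemma prob_not_reconstructible_few_isolated_edges:
  assumes fin: "finite I" "finite J" and n: "card I = n" "card J = n" and p: "0 \<le> p" "p \<le> 1 / 2"
    and z: "n * (p\<^sup>2 * exp (- (p * n / 12))) \<le> 1 / 2"
  shows "measure_pmf.prob (random_subgraph I J p)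
      {E. \<not> reconstructible I J E \<and> card (isolated_edges E) \<le> 1} \<le>
    10 ^ 360 * exp 3 * n * (2 * (p * n) ^ 2 + 4 * (p * n) ^ 3) * exp (- (27 / 10 * (p * n))) +
    4 * (n * (p\<^sup>2 * exp (- (p * n / 12))))\<^sup>2"
proof -
  let ?M = "random_subgraph I J p"
  let ?A = "\<lambda>E. \<exists>t \<in> two_edge_configs I J \<union> three_edge_configs I J. low_config E t"
  let ?B = "\<lambda>E. \<exists>\<sigma> \<rho>. automorphism I J E \<sigma> \<rho> \<and> \<sigma> \<noteq> id \<and> \<rho> \<noteq> id \<and>
        6 * (card {i. \<sigma> i \<noteq> i} + card {j. \<rho> j \<noteq> j}) \<le> card (E \<inter> moved_cells I J \<sigma> \<rho>)"
  have "measure_pmf.prob ?M {E. \<not> reconstructible I J E \<and> card (isolated_edges E) \<le> 1} \<le>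
      measure_pmf.prob ?M {E. ?A E \<or> ?B E}"
  proof (rule prob_random_subgraph_mono)
    fix E assume E: "E \<subseteq> I \<times> J" and h: "\<not> reconstructible I J E \<and> card (isolated_edges E) \<le> 1"
    show "?A E \<or> ?B E"
    proof (rule disjCI)
      assume "\<not> ?B E"
      show "?A E"
      proof (rule ccontr)
        assume nA: "\<not> ?A E"
        have "?B E"
        proof (rule automorphism_many_moved_edges[OF fin E])
          show "\<not> reconstructible I J E" "card (isolated_edges E) \<le> 1" using h by blast+
          show "\<not> low_config E t" if "t \<in> two_edge_configs I J" for t using nA that by blast
          show "\<not> low_config E t" if "t \<in> three_edge_configs I J" for t using nA that by blast
        qed blast
        with \<open>\<not> ?B E\<close> show False by blast
      qed
    qed
  qed
  also have "\<dots> \<le> measure_pmf.prob ?M {E. ?A E} + measure_pmf.prob ?M {E. ?B E}"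
    unfolding Collect_disj_eq by (intro measure_Un_le) auto
  also have "\<dots> \<le> 10 ^ 360 * exp 3 * n * (2 * (p * n) ^ 2 + 4 * (p * n) ^ 3) * exp (- (27 / 10 * (p * n))) +
    4 * (n * (p\<^sup>2 * exp (- (p * n / 12))))\<^sup>2"
    by (intro add_mono prob_some_low_config[OF fin n p]
        prob_some_automorphism_many_moved_edges[OF fin n p z])
  finally show ?thesis .
qed

section \<open>Moments of the number of isolated edges\<close>

lemma prod_diff_eq_binomial_fact: "prod ((-) n) {0..<k} = (n choose k) * fact k"
proof (induction k)
  case (Suc k)
  have "(n choose k) * (n - k) = Suc k * (n choose Suc k)"
    using binomial_absorption[of k n] binomial_absorb_comp[of n k] by (simp add: mult.commute)
  then have "(n choose k) * fact k * (n - k) = (n choose Suc k) * fact (Suc k)"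
    by (simp add: algebra_simps)
  then show ?case using Suc by simp
qed simp

definition matchings :: "'a set \<Rightarrow> 'b set \<Rightarrow> nat \<Rightarrow> ('a \<times> 'b) set set" where
  "matchings I J k = {B. B \<subseteq> I \<times> J \<and> card B = k \<and> inj_on fst B \<and> inj_on snd B}"

lemma card_matchings:
  assumes fin: "finite I" "finite J" and n: "card I = n" "card J = n"
  shows "finite (matchings I J k)" "card (matchings I J k) = (n choose k)\<^sup>2 * fact k"
proof -
  have "matchings I J k \<subseteq> Pow (I \<times> J)" by (auto simp: matchings_def)
  then show "finite (matchings I J k)" using fin by (rule_tac finite_subset) auto
  let ?\<D> = "{D. D \<subseteq> I \<and> card D = k}"
  let ?F = "\<lambda>D. {f \<in> D \<rightarrow>\<^sub>E J. inj_on f D}"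
  let ?g = "\<lambda>D f. (\<lambda>i. (i, f i)) ` D"
  have fD: "finite D" if "D \<in> ?\<D>" for D using that fin by (auto intro: finite_subset)
  have fF: "finite (?F D)" if "D \<in> ?\<D>" for D
    using finite_PiE[OF fD[OF that], of "\<lambda>_. J"] fin by simp
  have fst_g: "fst ` ?g D f = D" for D and f :: "'a \<Rightarrow> 'b" by (auto simp: image_image)
  have eq: "matchings I J k = (\<Union>D\<in>?\<D>. ?g D ` ?F D)"
  proof (intro equalityI subsetI)
    fix B assume "B \<in> matchings I J k"
    then have B: "B \<subseteq> I \<times> J" "card B = k" "inj_on fst B" "inj_on snd B" by (auto simp: matchings_def)
    define f where "f = restrict (\<lambda>i. snd (inv_into B fst i)) (fst ` B)"
    have f: "f (fst e) = snd e" if "e \<in> B" for e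
      using that B(3) by (simp add: f_def inv_into_f_f)
    have "fst ` B \<in> ?\<D>" using B by (auto simp: card_image)
    moreover have "f \<in> ?F (fst ` B)"
    proof -
      have "f \<in> fst ` B \<rightarrow>\<^sub>E J"
      proof
        fix i assume "i \<in> fst ` B"
        then obtain e where e: "e \<in> B" "i = fst e" by blast
        then show "f i \<in> J" using f B(1) by (metis mem_Times_iff subsetD)
      qed (simp add: f_def)
      moreover have "inj_on f (fst ` B)"
        using f B(4) by (auto simp: inj_on_def)
      ultimately show ?thesis by simp
    qed
    moreover have "?g (fst ` B) f = B" using f by (force simp: image_image)
    ultimately show "B \<in> (\<Union>D\<in>?\<D>. ?g D ` ?F D)" by (intro UN_I[of "fst ` B"] image_eqI[of _ _ f]) auto
  next
    fix B assume "B \<in> (\<Union>D\<in>?\<D>. ?g D ` ?F D)"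
    then obtain D f where D: "D \<subseteq> I" "card D = k" and f: "f \<in> D \<rightarrow>\<^sub>E J" "inj_on f D" and B: "B = ?g D f"
      by auto
    have "card B = k" unfolding B using D by (subst card_image) (auto simp: inj_on_def)
    then show "B \<in> matchings I J k"
      using D f by (auto simp: matchings_def B inj_on_def PiE_iff)
  qed
  have "card (matchings I J k) = (\<Sum>D\<in>?\<D>. card (?g D ` ?F D))"
    unfolding eq
  proof (rule card_UN_disjoint)
    show "finite ?\<D>" by (rule finite_subset[of _ "Pow I"]) (use fin(1) in auto)
    show "\<forall>D\<in>?\<D>. finite (?g D ` ?F D)" using fF by blast
    show "\<forall>D\<in>?\<D>. \<forall>D'\<in>?\<D>. D \<noteq> D' \<longrightarrow> ?g D ` ?F D \<inter> ?g D' ` ?F D' = {}"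
    proof (intro ballI impI)
      fix D D' :: "'a set" assume ne: "D \<noteq> D'"
      have False if B: "B \<in> ?g D ` ?F D" "B \<in> ?g D' ` ?F D'" for B
      proof -
        obtain f f' where f: "B = ?g D f" "B = ?g D' f'" using B by blast
        have "fst ` B = D" unfolding f(1) by (rule fst_g)
        moreover have "fst ` B = D'" unfolding f(2) by (rule fst_g)
        ultimately show False using ne by simp
      qed
      then show "?g D ` ?F D \<inter> ?g D' ` ?F D' = {}" by blast
    qed
  qed
  also have "\<dots> = (\<Sum>D\<in>?\<D>. (n choose k) * fact k)"
  proof (intro sum.cong refl)
    fix D assume D: "D \<in> ?\<D>"
    have "inj_on (?g D) (?F D)"
    proof (rule inj_onI)
      fix f f' assume f: "f \<in> ?F D" "f' \<in> ?F D" and eq: "?g D f = ?g D f'"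
      have "f i = f' i" if "i \<in> D" for i
      proof -
        have "(i, f i) \<in> ?g D f'" using that eq by blast
        then show ?thesis by auto
      qed
      then show "f = f'" using f by (auto intro: PiE_ext)
    qed
    then have "card (?g D ` ?F D) = card (?F D)" by (rule card_image)
    also have "\<dots> = prod ((-) n) {0..<k}"
      using card_inj_on_subset_funcset[OF fD[OF D] fin(2), of D] D n by simp
    finally show "card (?g D ` ?F D) = (n choose k) * fact k" by (simp add: prod_diff_eq_binomial_fact)
  qed
  also have "\<dots> = (n choose k)\<^sup>2 * fact k"
    using n_subsets[OF fin(1), of k] n by (simp add: power2_eq_square)
  finally show "card (matchings I J k) = (n choose k)\<^sup>2 * fact k" .
qed

text \<open>
  The rows and columns of a \<open>k\<close>-matching cover \<open>2 k n - k\<^sup>2\<close> cells, of which exactly the \<open>k\<close> cells of the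
  matching are to be present.
\<close>

lemma prob_matching_isolated:
  assumes fin: "finite I" "finite J" and n: "card I = n" "card J = n" and p: "0 \<le> p" "p \<le> 1"
    and B: "B \<in> matchings I J k"
  shows "measure_pmf.prob (random_subgraph I J p) {E. B \<subseteq> isolated_edges E} =
    p ^ k * (1 - p) ^ (k * (2 * n - k - 1))"
proof -
  let ?P = "measure_pmf.prob (random_subgraph I J p)"
  have BIJ: "B \<subseteq> I \<times> J" and cB: "card B = k" and inj: "inj_on fst B" "inj_on snd B"
    using B by (auto simp: matchings_def)
  have fB: "finite B" using BIJ fin by (auto intro: finite_subset)
  define C where "C = fst ` B \<times> J \<union> I \<times> snd ` B"
  have sub: "fst ` B \<subseteq> I" "snd ` B \<subseteq> J" using BIJ by auto
  have BC: "B \<subseteq> C" using BIJ by (force simp: C_def)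
  have k: "card (fst ` B) = k" "card (snd ` B) = k" using inj cB by (simp_all add: card_image)
  have kn: "k \<le> n" using card_mono[OF fin(1) sub(1)] k n by simp
  have "card C + card (fst ` B \<times> J \<inter> I \<times> snd ` B) = k * n + n * k"
    using card_Un_Int[of "fst ` B \<times> J" "I \<times> snd ` B"] fB fin n k
    by (simp add: C_def card_cartesian_product)
  also have "fst ` B \<times> J \<inter> I \<times> snd ` B = fst ` B \<times> snd ` B" using sub by blast
  finally have "card C + k * k = 2 * (k * n)" by (simp add: card_cartesian_product k)
  moreover have "card (C - B) = card C - k" using BC fB cB by (simp add: card_Diff_subset)
  ultimately have cC: "card (C - B) = k * (2 * n - k - 1)" using kn
    by (simp add: diff_mult_distrib2 algebra_simps)
  have "B \<subseteq> isolated_edges E \<longleftrightarrow> B \<subseteq> E \<and> E \<inter> (C - B) = {}" if E: "E \<subseteq> I \<times> J" for E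
  proof
    assume h: "B \<subseteq> isolated_edges E"
    have "(i, j) \<in> B" if ij: "(i, j) \<in> E" "(i, j) \<in> C" for i j
    proof -
      consider j' where "(i, j') \<in> B" | i' where "(i', j) \<in> B" using ij(2) by (auto simp: C_def)
      then show ?thesis
      proof cases
        case 1
        then have "E `` {i} = {j'}" using h by (auto simp: isolated_edges_def)
        then show ?thesis using ij 1 by auto
      next
        case 2
        then have "E\<inverse> `` {j} = {i'}" using h by (auto simp: isolated_edges_def)
        then show ?thesis using ij 2 by auto
      qed
    qed
    moreover have "B \<subseteq> E" using h by (auto simp: isolated_edges_def)
    ultimately show "B \<subseteq> E \<and> E \<inter> (C - B) = {}" by auto
  next
    assume h: "B \<subseteq> E \<and> E \<inter> (C - B) = {}"
    show "B \<subseteq> isolated_edges E"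
    proof
      fix e assume e: "e \<in> B"
      obtain i j where ij: "e = (i, j)" by (cases e)
      have "j' = j" if "(i, j') \<in> E" for j'
      proof -
        have "(i, j') \<in> C" using that E e ij by (force simp: C_def)
        then have "(i, j') \<in> B" using h that by blast
        then show ?thesis using inj_onD[OF inj(1), of "(i, j')" "(i, j)"] e ij by simp
      qed
      moreover have "i' = i" if "(i', j) \<in> E" for i'
      proof -
        have "(i', j) \<in> C" using that E e ij by (force simp: C_def)
        then have "(i', j) \<in> B" using h that by blast
        then show ?thesis using inj_onD[OF inj(2), of "(i', j)" "(i, j)"] e ij by simp
      qed
      moreover have "(i, j) \<in> E" using h e ij by blast
      ultimately have "E `` {i} = {j}" "E\<inverse> `` {j} = {i}" by blast+
      then show "e \<in> isolated_edges E" using \<open>(i, j) \<in> E\<close> by (simp add: isolated_edges_def ij)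
    qed
  qed
  then have "?P {E. B \<subseteq> isolated_edges E} = ?P {E. B \<subseteq> E \<and> E \<inter> (C - B) = {}}"
    by (intro antisym prob_random_subgraph_mono) blast+
  also have "\<dots> = p ^ card B * (1 - p) ^ card (C - B)"
    using BIJ sub by (intro prob_random_subgraph_cylinder fin p) (auto simp: C_def)
  finally show ?thesis by (simp add: cB cC)
qed

lemma isolated_edges_matching:
  assumes "B \<subseteq> isolated_edges E"
  shows "inj_on fst B" "inj_on snd B"
proof -
  have "inj_on fst (isolated_edges E)" "inj_on snd (isolated_edges E)"
    by (auto simp: isolated_edges_def inj_on_def)
  then show "inj_on fst B" "inj_on snd B" using assms by (auto intro: inj_on_subset)
qed

lemma random_subgraph_integrable:
  assumes "finite I" "finite J"
  shows "integrable (measure_pmf (random_subgraph I J p)) (f :: _ \<Rightarrow> real)"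
  by (intro integrable_measure_pmf_finite finite_subset[OF set_pmf_random_subgraph]) (simp add: assms)

text \<open>
  The \<open>k\<close>-subsets of the set of isolated edges are the \<open>k\<close>-matchings whose edges are isolated.
\<close>

lemma expectation_isolated_edges_choose:
  assumes fin: "finite I" "finite J" and n: "card I = n" "card J = n" and p: "0 \<le> p" "p \<le> 1"
  shows "measure_pmf.expectation (random_subgraph I J p) (\<lambda>E. real (card (isolated_edges E) choose k)) =
    real ((n choose k)\<^sup>2 * fact k) * (p ^ k * (1 - p) ^ (k * (2 * n - k - 1)))"
proof -
  let ?M = "random_subgraph I J p"
  let ?\<B> = "matchings I J k"
  note m = card_matchings[OF fin n, of k]
  have "measure_pmf.expectation ?M (\<lambda>E. real (card (isolated_edges E) choose k)) =
      measure_pmf.expectation ?M (\<lambda>E. \<Sum>B\<in>?\<B>. indicator {E. B \<subseteq> isolated_edges E} E)"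
  proof (rule integral_cong_AE)
    have "real (card (isolated_edges E) choose k) = (\<Sum>B\<in>?\<B>. indicator {E. B \<subseteq> isolated_edges E} E)"
      if E: "E \<in> set_pmf ?M" for E
    proof -
      have EIJ: "E \<subseteq> I \<times> J" using E set_pmf_random_subgraph by blast
      then have iIJ: "isolated_edges E \<subseteq> I \<times> J" by (auto simp: isolated_edges_def)
      then have fi: "finite (isolated_edges E)" using fin by (auto intro: finite_subset)
      have "(\<Sum>B\<in>?\<B>. indicator {E. B \<subseteq> isolated_edges E} E) =
          real (card {B \<in> ?\<B>. B \<subseteq> isolated_edges E})"
        using m(1) by (simp add: indicator_def sum.If_cases Int_def)
      also have "{B \<in> ?\<B>. B \<subseteq> isolated_edges E} = {B. B \<subseteq> isolated_edges E \<and> card B = k}"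
        using isolated_edges_matching[of _ E] order.trans[OF _ iIJ]
        by (intro Collect_cong) (auto simp only: matchings_def mem_Collect_eq)
      also have "card \<dots> = card (isolated_edges E) choose k" using fi by (rule n_subsets)
      finally show ?thesis by simp
    qed
    then show "AE E in measure_pmf ?M. real (card (isolated_edges E) choose k) =
        (\<Sum>B\<in>?\<B>. indicator {E. B \<subseteq> isolated_edges E} E)"
      by (simp add: AE_measure_pmf_iff)
  qed simp_all
  also have "\<dots> = (\<Sum>B\<in>?\<B>. measure_pmf.expectation ?M (indicator {E. B \<subseteq> isolated_edges E}))"
    by (intro Bochner_Integration.integral_sum random_subgraph_integrable fin)
  also have "\<dots> = (\<Sum>B\<in>?\<B>. p ^ k * (1 - p) ^ (k * (2 * n - k - 1)))"
    using prob_matching_isolated[OF fin n p] by (intro sum.cong refl) simp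
  also have "\<dots> = real ((n choose k)\<^sup>2 * fact k) * (p ^ k * (1 - p) ^ (k * (2 * n - k - 1)))"
    using m(2) by simp
  finally show ?thesis .
qed

text \<open>
  The coefficients \<open>(- 1)\<^sup>k (1 - k)\<close> are the sums of those in the inclusion-exclusion formulas for \<open>x = 0\<close>
  and \<open>x = 1\<close>.  Truncated alternating sums of binomial coefficients have a closed form,
  which bounds the error of the truncation.
\<close>

lemma bonferroni_at_most_one:
  assumes m: "m \<ge> 2"
  shows "\<bar>(if x \<le> 1 then 1 else 0) - (\<Sum>k\<le>m. (- 1) ^ k * (1 - real k) * real (x choose k))\<bar> \<le>
    real (m + 1) * real (x choose m)"
proof -
  define S where "S = (\<Sum>k\<le>m. (- 1) ^ k * (1 - real k) * real (x choose k))"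
  consider "x = 0" | "x = 1" | y where "x = Suc (Suc y)" by (metis One_nat_def not0_implies_Suc)
  then show ?thesis
  proof cases
    case 1
    have "S = (\<Sum>k\<in>{0}. (- 1) ^ k * (1 - real k) * real (x choose k))"
      unfolding S_def using 1 by (intro sum.mono_neutral_right) auto
    then show ?thesis unfolding S_def[symmetric] using 1 m by simp
  next
    case 2
    have "S = (\<Sum>k\<in>{0, 1}. (- 1) ^ k * (1 - real k) * real (x choose k))"
      unfolding S_def using 2 m by (intro sum.mono_neutral_right) (auto simp: binomial_eq_0)
    then show ?thesis unfolding S_def[symmetric] using 2 m by (simp add: binomial_eq_0)
  next
    case 3
    have alt: "(\<Sum>k\<le>m. (- 1) ^ k * real (Suc a choose k)) = (- 1) ^ m * real (a choose m)" for a m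
      using gbinomial_sum_lower_neg[of "real (Suc a)" m]
      by (simp add: binomial_gbinomial mult.commute)
    obtain l where l: "m = Suc l" using m by (cases m) auto
    have "S = (\<Sum>k\<le>m. (- 1) ^ k * real (x choose k)) - (\<Sum>k\<le>m. (- 1) ^ k * (real k * real (x choose k)))"
      unfolding S_def sum_subtractf[symmetric] by (intro sum.cong refl) (simp add: algebra_simps)
    also have "(\<Sum>k\<le>m. (- 1) ^ k * real (x choose k)) = (- 1) ^ m * real (Suc y choose m)"
      unfolding 3 by (rule alt)
    also have "(\<Sum>k\<le>m. (- 1) ^ k * (real k * real (x choose k))) =
        (\<Sum>k\<le>l. (- 1) ^ Suc k * (real (Suc k) * real (x choose Suc k)))"
      unfolding l by (subst sum.atMost_Suc_shift) simp
    also have "\<dots> = (\<Sum>k\<le>l. - real x * ((- 1) ^ k * real (Suc y choose k)))"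
    proof (intro sum.cong refl)
      fix k
      have "Suc k * (x choose Suc k) = x * (Suc y choose k)"
        using binomial_absorption[of k x] 3 by simp
      then have "real (Suc k) * real (x choose Suc k) = real x * real (Suc y choose k)"
        by (metis of_nat_mult)
      then show "(- 1) ^ Suc k * (real (Suc k) * real (x choose Suc k)) =
          - real x * ((- 1) ^ k * real (Suc y choose k))" by simp
    qed
    also have "\<dots> = - real x * ((- 1) ^ l * real (y choose l))"
      by (simp only: sum_distrib_left[symmetric] alt)
    finally have "S = (- 1) ^ m * real (Suc y choose m) + real x * ((- 1) ^ l * real (y choose l))"
      by simp
    then have "\<bar>S\<bar> \<le> real (Suc y choose m) + real x * real (y choose l)"
      by (simp add: abs_mult order.trans[OF abs_triangle_ineq])
    also have "real (Suc y choose m) \<le> real (x choose m)"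
      unfolding 3 l by (simp add: binomial_mono)
    also have "real x * real (y choose l) \<le> real m * real (x choose m)"
    proof -
      have "x * (y choose l) \<le> x * (Suc y choose l)" by (cases l) simp_all
      also have "\<dots> = m * (x choose m)" using binomial_absorption[of l x] 3 l by simp
      finally show ?thesis by (metis of_nat_mult of_nat_mono)
    qed
    finally show ?thesis unfolding S_def[symmetric] using 3 by (simp add: algebra_simps)
  qed
qed

lemma prob_at_most_one_bonferroni:
  fixes X :: "'a \<Rightarrow> nat"
  assumes fin: "finite (set_pmf M)" and m: "m \<ge> 2"
  shows "\<bar>measure_pmf.prob M {x. X x \<le> 1} -
      (\<Sum>k\<le>m. (- 1) ^ k * (1 - real k) * measure_pmf.expectation M (\<lambda>x. real (X x choose k)))\<bar> \<le>
    real (m + 1) * measure_pmf.expectation M (\<lambda>x. real (X x choose m))"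
proof -
  have int: "integrable (measure_pmf M) f" for f :: "'a \<Rightarrow> real"
    using fin by (rule integrable_measure_pmf_finite)
  let ?D = "\<lambda>x. (if X x \<le> 1 then 1 else 0) - (\<Sum>k\<le>m. (- 1) ^ k * (1 - real k) * real (X x choose k))"
  have "measure_pmf.prob M {x. X x \<le> 1} = measure_pmf.expectation M (indicator {x. X x \<le> 1})" by simp
  also have "\<dots> = measure_pmf.expectation M (\<lambda>x. if X x \<le> 1 then 1 else 0)"
    by (intro Bochner_Integration.integral_cong refl) (simp add: indicator_def)
  finally have "measure_pmf.prob M {x. X x \<le> 1} -
      (\<Sum>k\<le>m. (- 1) ^ k * (1 - real k) * measure_pmf.expectation M (\<lambda>x. real (X x choose k))) =
    measure_pmf.expectation M ?D"
    by (simp add: int Bochner_Integration.integral_diff Bochner_Integration.integral_sum)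
  also have "\<bar>\<dots>\<bar> \<le> measure_pmf.expectation M (\<lambda>x. \<bar>?D x\<bar>)" by (rule integral_abs_bound)
  also have "\<dots> \<le> measure_pmf.expectation M (\<lambda>x. real (m + 1) * real (X x choose m))"
    using bonferroni_at_most_one[OF m] by (intro integral_mono int)
  also have "\<dots> = real (m + 1) * measure_pmf.expectation M (\<lambda>x. real (X x choose m))" by simp
  finally show ?thesis .
qed

lemma prob_at_most_one_chebyshev:
  fixes X :: "'a \<Rightarrow> nat"
  assumes fin: "finite (set_pmf M)"
  defines "\<mu> \<equiv> measure_pmf.expectation M (\<lambda>x. real (X x))"
  assumes \<mu>: "\<mu> > 1"
  shows "measure_pmf.prob M {x. X x \<le> 1} * (\<mu> - 1)\<^sup>2 \<le>
    2 * measure_pmf.expectation M (\<lambda>x. real (X x choose 2)) + \<mu> - \<mu>\<^sup>2"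
proof -
  have int: "integrable (measure_pmf M) f" for f :: "'a \<Rightarrow> real"
    using fin by (rule integrable_measure_pmf_finite)
  have "measure_pmf.prob M {x. X x \<le> 1} * (\<mu> - 1)\<^sup>2 =
      measure_pmf.expectation M (\<lambda>x. indicator {x. X x \<le> 1} x * (\<mu> - 1)\<^sup>2)" by simp
  also have "\<dots> \<le> measure_pmf.expectation M (\<lambda>x. 2 * real (X x choose 2) + real (X x) - 2 * \<mu> * real (X x) + \<mu>\<^sup>2)"
  proof (intro integral_mono int)
    fix x
    have "even (X x * (X x - 1))" by (cases "X x") auto
    then have "2 * (X x choose 2) = X x * (X x - 1)" by (simp add: choose_two)
    then have "2 * real (X x choose 2) = real (X x * (X x - 1))" by (metis of_nat_mult of_nat_numeral)
    also have "\<dots> = real (X x) * real (X x) - real (X x)" by (cases "X x") (simp_all add: algebra_simps)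
    finally have eq: "2 * real (X x choose 2) + real (X x) - 2 * \<mu> * real (X x) + \<mu>\<^sup>2 = (\<mu> - real (X x))\<^sup>2"
      by (simp add: power2_eq_square algebra_simps)
    have "(\<mu> - 1)\<^sup>2 \<le> (\<mu> - real (X x))\<^sup>2" if "X x \<le> 1" using that \<mu> by (intro power_mono) auto
    then show "indicator {x. X x \<le> 1} x * (\<mu> - 1)\<^sup>2 \<le>
        2 * real (X x choose 2) + real (X x) - 2 * \<mu> * real (X x) + \<mu>\<^sup>2"
      unfolding eq by (simp add: indicator_def)
  qed
  also have "\<dots> = 2 * measure_pmf.expectation M (\<lambda>x. real (X x choose 2)) + \<mu> - 2 * \<mu> * \<mu> + \<mu>\<^sup>2"
    by (simp add: int \<mu>_def)
  finally show ?thesis by (simp add: power2_eq_square)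
qed

text \<open>
  The second binomial moment exceeds \<open>\<mu>\<^sup>2 / 2\<close> at most by the factor \<open>1 / (1 - p)\<^sup>2\<close>, which comes from the
  two cells that lie in the row of one edge and the column of the other; so the variance is at
  most \<open>\<mu> + 8 p \<mu>\<^sup>2\<close>.
\<close>

lemma prob_at_most_one_isolated_edge_le:
  assumes fin: "finite I" "finite J" and n: "card I = n" "card J = n" and p: "0 \<le> p" "p \<le> 1 / 2"
    and \<mu>_def: "\<mu> = real n ^ 2 * p * (1 - p) ^ (2 * n - 2)" and \<mu>: "\<mu> \<ge> 2"
  shows "measure_pmf.prob (random_subgraph I J p) {E. card (isolated_edges E) \<le> 1} \<le> 4 / \<mu> + 32 * p"
proof -
  let ?M = "random_subgraph I J p"
  let ?E = "measure_pmf.expectation ?M"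
  let ?X = "\<lambda>E. card (isolated_edges E)"
  define Q where "Q = measure_pmf.prob ?M {E. ?X E \<le> 1}"
  have p1: "p \<le> 1" using p by simp
  have n2: "n \<ge> 2"
  proof (rule ccontr)
    assume "\<not> n \<ge> 2"
    then have "n = 0 \<or> n = 1" by auto
    then show False using \<mu> p by (auto simp: \<mu>_def)
  qed
  have fs: "finite (set_pmf ?M)" by (rule finite_subset[OF set_pmf_random_subgraph]) (simp add: fin)
  have E1: "?E (\<lambda>E. real (?X E)) = \<mu>"
    using expectation_isolated_edges_choose[OF fin n p(1) p1, of 1] by (simp add: \<mu>_def mult.assoc numeral_2_eq_2)
  have E2: "2 * ?E (\<lambda>E. real (?X E choose 2)) \<le> \<mu>\<^sup>2 + 8 * p * \<mu>\<^sup>2"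
  proof -
    have q: "(1 - p)\<^sup>2 > 0" using p by simp
    have ev: "real (n choose 2) * 2 = real n * (real n - 1)"
    proof -
      have "even (n * (n - 1))" by (cases n) auto
      then have "2 * (n choose 2) = n * (n - 1)" by (simp add: choose_two)
      then have "2 * real (n choose 2) = real (n * (n - 1))" by (metis of_nat_mult of_nat_numeral)
      then show ?thesis using n2 by (simp add: of_nat_diff)
    qed
    have "2 * (2 * n - 3) + 2 = 2 * (2 * n - 2)" using n2 by simp
    then have pw: "(1 - p) ^ (2 * (2 * n - 3)) * (1 - p)\<^sup>2 = ((1 - p) ^ (2 * n - 2))\<^sup>2"
      by (metis power_add power_mult mult.commute)
    have "2 * ?E (\<lambda>E. real (?X E choose 2)) * (1 - p)\<^sup>2 =
        2 * (real ((n choose 2)\<^sup>2 * fact 2) * (p\<^sup>2 * (1 - p) ^ (2 * (2 * n - 3)))) * (1 - p)\<^sup>2"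
      using expectation_isolated_edges_choose[OF fin n p(1) p1, of 2] by (simp add: numeral_2_eq_2 numeral_3_eq_3)
    also have "\<dots> = (real (n choose 2) * 2)\<^sup>2 * p\<^sup>2 * ((1 - p) ^ (2 * (2 * n - 3)) * (1 - p)\<^sup>2)"
      by (simp add: power_mult_distrib)
    also have "\<dots> = (real n * (real n - 1) * p * (1 - p) ^ (2 * n - 2))\<^sup>2"
      unfolding ev pw by (simp add: power_mult_distrib)
    also have "\<dots> \<le> \<mu>\<^sup>2"
      unfolding \<mu>_def using n2 p
      by (intro power_mono mult_right_mono mult_nonneg_nonneg) (auto simp: power2_eq_square)
    finally have a: "2 * ?E (\<lambda>E. real (?X E choose 2)) * (1 - p)\<^sup>2 \<le> \<mu>\<^sup>2" .
    have "1 \<le> (1 + 8 * p) * (1 - p)\<^sup>2"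
    proof -
      have "(1 + 8 * p) * (1 - p)\<^sup>2 - 1 = p * (6 - 15 * p + 8 * p\<^sup>2)"
        by (simp add: power2_eq_square algebra_simps)
      moreover have "0 \<le> 6 - 15 * p + 8 * p\<^sup>2"
      proof -
        have "0 \<le> (1 - 2 * p) * (1 - 2 * p)" by simp
        then show ?thesis using p by (simp add: power2_eq_square algebra_simps)
      qed
      ultimately show ?thesis using p by (metis diff_ge_0_iff_ge mult_nonneg_nonneg)
    qed
    then have "\<mu>\<^sup>2 * 1 \<le> \<mu>\<^sup>2 * ((1 + 8 * p) * (1 - p)\<^sup>2)" by (intro mult_left_mono) auto
    then have "2 * ?E (\<lambda>E. real (?X E choose 2)) * (1 - p)\<^sup>2 \<le> (\<mu>\<^sup>2 * (1 + 8 * p)) * (1 - p)\<^sup>2"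
      using a by (simp add: mult.assoc)
    then have "2 * ?E (\<lambda>E. real (?X E choose 2)) \<le> \<mu>\<^sup>2 * (1 + 8 * p)"
      using q by (rule mult_right_le_imp_le)
    then show ?thesis by (simp add: algebra_simps)
  qed
  have "Q * (\<mu> - 1)\<^sup>2 \<le> 2 * ?E (\<lambda>E. real (?X E choose 2)) + \<mu> - \<mu>\<^sup>2"
    using prob_at_most_one_chebyshev[OF fs, of ?X] \<mu> unfolding E1 Q_def by simp
  also have "\<dots> \<le> \<mu> + 8 * p * \<mu>\<^sup>2" using E2 by simp
  finally have b: "Q * (\<mu> - 1)\<^sup>2 \<le> \<mu> + 8 * p * \<mu>\<^sup>2" .
  have "(\<mu> / 2)\<^sup>2 \<le> (\<mu> - 1)\<^sup>2" using \<mu> by (intro power_mono) auto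
  then have "Q * (\<mu> / 2)\<^sup>2 \<le> Q * (\<mu> - 1)\<^sup>2" by (intro mult_left_mono) (auto simp: Q_def)
  then have "Q * \<mu>\<^sup>2 \<le> 4 * (\<mu> + 8 * p * \<mu>\<^sup>2)" using b by (simp add: power_divide)
  then have "Q \<le> 4 * (\<mu> + 8 * p * \<mu>\<^sup>2) / \<mu>\<^sup>2" using \<mu> by (simp add: pos_le_divide_eq)
  also have "\<dots> = 4 / \<mu> + 32 * p" using \<mu> by (simp add: field_simps power2_eq_square)
  finally show ?thesis by (simp add: Q_def)
qed

text \<open>
  In a graph with two edges and fewer than two isolated ones, some two edges meet.  This covers the
  range in which the mean number of edges is too small for Chebyshev's inequality.
\<close>

lemma prob_two_edges_not_two_isolated_le:
  assumes fin: "finite I" "finite J" and n: "card I = n" "card J = n" and p: "0 \<le> p" "p \<le> 1"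
  shows "measure_pmf.prob (random_subgraph I J p) {E. 2 \<le> card E \<and> card (isolated_edges E) \<le> 1} \<le>
    2 * real n ^ 3 * p\<^sup>2"
proof -
  let ?P = "measure_pmf.prob (random_subgraph I J p)"
  note two = card_two_edge_configs[OF fin n]
  have "?P {E. 2 \<le> card E \<and> card (isolated_edges E) \<le> 1} \<le> ?P {E. \<exists>t\<in>two_edge_configs I J. fst t \<subseteq> E}"
  proof (rule prob_random_subgraph_mono)
    fix E assume E: "E \<subseteq> I \<times> J" and h: "2 \<le> card E \<and> card (isolated_edges E) \<le> 1"
    then have "isolated_edges E \<noteq> E" by auto
    then obtain i j where ij: "(i, j) \<in> E" "(i, j) \<notin> isolated_edges E"
      by (auto simp: isolated_edges_def)
    then consider j' where "(i, j') \<in> E" "j \<noteq> j'" | i' where "(i', j) \<in> E" "i \<noteq> i'"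
      by (auto simp: isolated_edges_def)
    then show "\<exists>t\<in>two_edge_configs I J. fst t \<subseteq> E"
    proof cases
      case 1
      then have "({(i, j), (i, j')}, {i}, {j, j'}) \<in> two_edge_configs I J"
        using ij E by (intro configs_intros) auto
      then show ?thesis using ij 1 by (intro bexI) auto
    next
      case 2
      then have "({(i, j), (i', j)}, {i, i'}, {j}) \<in> two_edge_configs I J"
        using ij E by (intro configs_intros) auto
      then show ?thesis using ij 2 by (intro bexI) auto
    qed
  qed
  also have "\<dots> \<le> ?P (\<Union>t\<in>two_edge_configs I J. {E. fst t \<subseteq> E})"
    by (intro measure_pmf.finite_measure_mono) auto
  also have "\<dots> \<le> (\<Sum>t\<in>two_edge_configs I J. ?P {E. fst t \<subseteq> E})"
    using two by (intro measure_UNION_le) auto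
  also have "\<dots> = (\<Sum>t\<in>two_edge_configs I J. p\<^sup>2)"
  proof (intro sum.cong refl)
    fix t assume t: "t \<in> two_edge_configs I J"
    obtain F D K where t': "t = (F, D, K)" by (cases t)
    show "?P {E. fst t \<subseteq> E} = p\<^sup>2"
      using prob_random_subgraph_cylinder[OF fin p two_edge_configsD(1)[OF t[unfolded t']], of "{}"]
        two_edge_configsD(4)[OF t[unfolded t']] by (simp add: t')
  qed
  also have "\<dots> = card (two_edge_configs I J) * p\<^sup>2" by simp
  also have "\<dots> \<le> real (2 * n ^ 3) * p\<^sup>2" using two by (intro mult_right_mono of_nat_mono) auto
  finally show ?thesis by simp
qed

section \<open>Asymptotics\<close>

lemma prob_Collect_not: "measure_pmf.prob M {x. \<not> P x} = 1 - measure_pmf.prob M {x. P x}"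
proof -
  have "{x. \<not> P x} = space (measure_pmf M) - {x. P x}" by auto
  then show ?thesis using measure_pmf.prob_compl[of "{x. P x}" M] by simp
qed

text \<open>
  Since \<open>n \<le> exp (2 x)\<close> for \<open>x = p n\<close>, both error terms are bounded by functions of \<open>x\<close> alone that vanish at
  infinity, for all \<open>p\<close> up to \<open>1 / 2\<close> at once.
\<close>

lemma prob_not_reconstructible_few_isolated_edges_tendsto:
  fixes p :: "nat \<Rightarrow> real"
  assumes p: "\<And>n. n \<ge> 2 \<Longrightarrow> 0 \<le> p n \<and> p n \<le> 1 / 2"
    and lower: "eventually (\<lambda>n. ln (real n) / 2 \<le> p n * n) sequentially"
  shows "(\<lambda>n. measure_pmf.prob (random_Knn n (p n))
      {E. \<not> reconstructible {..<n} {..<n} E \<and> card (isolated_edges E) \<le> 1}) \<longlonglongrightarrow> 0"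
proof -
  define g :: "real \<Rightarrow> real" where "g x = (2 * x ^ 2 + 4 * x ^ 3) * exp (- (7 / 10 * x))" for x
  define h :: "real \<Rightarrow> real" where "h x = x ^ 2 * exp (- (x / 12))" for x
  define C :: real where "C = 10 ^ 360 * exp 3"
  have C0: "0 \<le> C" by (simp add: C_def)
  let ?x = "\<lambda>n. p n * real n"
  have "filterlim (\<lambda>n. ln (real n) / 2) at_top sequentially" by real_asymp
  then have x: "filterlim ?x at_top sequentially" using lower by (rule filterlim_at_top_mono)
  have "(g \<longlongrightarrow> 0) at_top" unfolding g_def by real_asymp
  then have g: "(\<lambda>n. g (?x n)) \<longlonglongrightarrow> 0" using x by (rule filterlim_compose)
  have "(h \<longlongrightarrow> 0) at_top" unfolding h_def by real_asymp
  then have h: "(\<lambda>n. h (?x n)) \<longlonglongrightarrow> 0" using x by (rule filterlim_compose)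
  have "eventually (\<lambda>n. h (?x n) < 1 / 2) sequentially" using h by (rule order_tendstoD) simp
  then have bound: "eventually (\<lambda>n. measure_pmf.prob (random_Knn n (p n))
      {E. \<not> reconstructible {..<n} {..<n} E \<and> card (isolated_edges E) \<le> 1} \<le>
      C * g (?x n) + 4 * (h (?x n))\<^sup>2) sequentially"
    using lower eventually_ge_at_top[of 2]
  proof eventually_elim
    case (elim n)
    let ?z = "n * ((p n)\<^sup>2 * exp (- (p n * n / 12)))"
    have p01: "0 \<le> p n" "p n \<le> 1 / 2" using p elim by auto
    have n1: "real n \<ge> 1" using elim by simp
    \<comment> \<open>The surplus factor \<open>1 / n\<close> in \<open>?z = x\<^sup>2 exp (- x / 12) / n\<close> is given away.\<close>
    have z: "?z \<le> h (?x n)"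
    proof -
      have "?z * 1 \<le> ?z * n" using n1 by (intro mult_left_mono) auto
      also have "\<dots> = h (?x n)" by (simp add: h_def power2_eq_square)
      finally show ?thesis by simp
    qed
    have "measure_pmf.prob (random_Knn n (p n))
        {E. \<not> reconstructible {..<n} {..<n} E \<and> card (isolated_edges E) \<le> 1} \<le>
      10 ^ 360 * exp 3 * n * (2 * ?x n ^ 2 + 4 * ?x n ^ 3) * exp (- (27 / 10 * ?x n)) + 4 * ?z\<^sup>2"
      using z elim p01 by (intro prob_not_reconstructible_few_isolated_edges) auto
    also have "\<dots> = C * (2 * ?x n ^ 2 + 4 * ?x n ^ 3) * (n * exp (- (27 / 10 * ?x n))) + 4 * ?z\<^sup>2"
      by (simp only: C_def mult_ac)
    also have "\<dots> \<le> C * (2 * ?x n ^ 2 + 4 * ?x n ^ 3) * exp (- (7 / 10 * ?x n)) + 4 * (h (?x n))\<^sup>2"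
    proof (intro add_mono mult_left_mono power_mono)
      have "real n = exp (ln n)" using n1 by simp
      also have "\<dots> \<le> exp (2 * ?x n)" unfolding exp_le_cancel_iff using elim by simp
      finally have "n * exp (- (27 / 10 * ?x n)) \<le> exp (2 * ?x n) * exp (- (27 / 10 * ?x n))"
        by (intro mult_right_mono) auto
      also have "\<dots> = exp (- (7 / 10 * ?x n))" by (simp add: exp_add[symmetric])
      finally show "n * exp (- (27 / 10 * ?x n)) \<le> exp (- (7 / 10 * ?x n))" .
    qed (use z p01 C0 in auto)
    finally show ?case by (simp only: g_def mult.assoc)
  qed
  have "(\<lambda>n. C * g (?x n) + 4 * (h (?x n))\<^sup>2) \<longlonglongrightarrow> C * 0 + 4 * 0\<^sup>2"
    by (intro tendsto_intros g h)
  then have lim: "(\<lambda>n. C * g (?x n) + 4 * (h (?x n))\<^sup>2) \<longlonglongrightarrow> 0" by simp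
  show ?thesis
    by (rule tendsto_sandwich[OF _ bound tendsto_const lim]) simp
qed

lemma binomial_fact_div_power_tendsto: "(\<lambda>n. real ((n choose k) * fact k) / real n ^ k) \<longlonglongrightarrow> 1"
proof -
  have "(\<lambda>n. real (n - i) / real n) \<longlonglongrightarrow> 1" for i
  proof (rule Lim_transform_eventually)
    show "(\<lambda>n. (real n - real i) / real n) \<longlonglongrightarrow> 1" by real_asymp
    show "eventually (\<lambda>n. (real n - real i) / real n = real (n - i) / real n) sequentially"
      using eventually_ge_at_top[of i] by eventually_elim (simp add: of_nat_diff)
  qed
  then have "(\<lambda>n. \<Prod>i\<in>{0..<k}. real (n - i) / real n) \<longlonglongrightarrow> (\<Prod>i\<in>{0..<k}. 1)"
    by (intro tendsto_prod)
  moreover have "(\<Prod>i\<in>{0..<k}. real (n - i) / real n) = real ((n choose k) * fact k) / real n ^ k" for n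
    unfolding prod_diff_eq_binomial_fact[symmetric] of_nat_prod by (simp add: prod_dividef)
  ultimately show ?thesis by simp
qed

lemma one_minus_power_approx:
  fixes p :: "nat \<Rightarrow> real"
  assumes p0: "p \<longlonglongrightarrow> 0" and p2: "(\<lambda>n. real n * (p n)\<^sup>2) \<longlonglongrightarrow> 0"
  shows "(\<lambda>n. (1 - p n) ^ (2 * n) * exp (2 * (p n * n))) \<longlonglongrightarrow> 1"
proof -
  have ev: "eventually (\<lambda>n. \<bar>p n\<bar> < 1 / 2) sequentially"
    using tendsto_rabs_zero[OF p0] by (rule order_tendstoD) simp
  have "(\<lambda>n. 2 * real n * (ln (1 - p n) + p n)) \<longlonglongrightarrow> 0"
  proof (rule Lim_null_comparison)
    show "eventually (\<lambda>n. norm (2 * real n * (ln (1 - p n) + p n)) \<le> 4 * (real n * (p n)\<^sup>2)) sequentially"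
      using ev
    proof eventually_elim
      case (elim n)
      have "\<bar>ln (1 + - p n) - (- p n)\<bar> \<le> 2 * (- p n)\<^sup>2"
        using elim by (intro abs_ln_one_plus_x_minus_x_bound) auto
      then have "2 * real n * \<bar>ln (1 - p n) + p n\<bar> \<le> 2 * real n * (2 * (p n)\<^sup>2)"
        by (intro mult_left_mono) auto
      then show ?case by (simp add: abs_mult)
    qed
    show "(\<lambda>n. 4 * (real n * (p n)\<^sup>2)) \<longlonglongrightarrow> 0"
      using tendsto_mult_left[OF p2, of 4] by simp
  qed
  then have "(\<lambda>n. exp (2 * real n * (ln (1 - p n) + p n))) \<longlonglongrightarrow> exp 0" by (intro tendsto_exp)
  then have lim: "(\<lambda>n. exp (2 * real n * (ln (1 - p n) + p n))) \<longlonglongrightarrow> 1" by simp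
  show ?thesis
  proof (rule Lim_transform_eventually[OF lim])
    show "eventually (\<lambda>n. exp (2 * real n * (ln (1 - p n) + p n)) =
        (1 - p n) ^ (2 * n) * exp (2 * (p n * n))) sequentially"
      using ev
    proof eventually_elim
      case (elim n)
      have "exp (2 * real n * (ln (1 - p n) + p n)) = exp (real (2 * n) * ln (1 - p n)) * exp (2 * (p n * n))"
        by (simp add: exp_add[symmetric] algebra_simps)
      also have "exp (real (2 * n) * ln (1 - p n)) = (1 - p n) ^ (2 * n)"
        unfolding exp_of_nat_mult using elim by simp
      finally show ?case .
    qed
  qed
qed

lemma expectation_isolated_edges_choose_tendsto:
  fixes p :: "nat \<Rightarrow> real"
  assumes p: "\<And>n. n \<ge> 2 \<Longrightarrow> 0 \<le> p n \<and> p n \<le> 1 / 2"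
    and p0: "p \<longlonglongrightarrow> 0" and p2: "(\<lambda>n. real n * (p n)\<^sup>2) \<longlonglongrightarrow> 0"
    and \<lambda>: "(\<lambda>n. real n * (p n * n) * exp (- (2 * (p n * n)))) \<longlonglongrightarrow> l"
  shows "(\<lambda>n. measure_pmf.expectation (random_Knn n (p n)) (\<lambda>E. real (card (isolated_edges E) choose k)))
    \<longlonglongrightarrow> l ^ k / fact k"
proof -
  let ?r = "\<lambda>n. (1 - p n) ^ (2 * n) * exp (2 * (p n * n))"
  let ?f = "\<lambda>n. real ((n choose k) * fact k) / real n ^ k"
  let ?m = "\<lambda>n. real n * (p n * n) * exp (- (2 * (p n * n)))"
  have "(\<lambda>n. ?f n ^ 2 / fact k * (?m n * ?r n) ^ k / (1 - p n) ^ (k * (k + 1))) \<longlonglongrightarrow>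
      1 ^ 2 / fact k * (l * 1) ^ k / (1 - 0) ^ (k * (k + 1))"
    by (intro tendsto_intros binomial_fact_div_power_tendsto one_minus_power_approx p0 p2 \<lambda>) simp_all
  then have lim: "(\<lambda>n. ?f n ^ 2 / fact k * (?m n * ?r n) ^ k / (1 - p n) ^ (k * (k + 1))) \<longlonglongrightarrow> l ^ k / fact k"
    by simp
  show ?thesis
  proof (rule Lim_transform_eventually[OF lim])
    show "eventually (\<lambda>n. ?f n ^ 2 / fact k * (?m n * ?r n) ^ k / (1 - p n) ^ (k * (k + 1)) =
        measure_pmf.expectation (random_Knn n (p n)) (\<lambda>E. real (card (isolated_edges E) choose k))) sequentially"
      using eventually_ge_at_top[of "k + 2"]
    proof eventually_elim
      case (elim n)
      have p01: "0 \<le> p n" "p n \<le> 1" and q: "1 - p n > 0" using p[of n] elim by auto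
      have n0: "real n > 0" using elim by simp
      have mr: "?m n * ?r n = real n ^ 2 * p n * (1 - p n) ^ (2 * n)"
        by (simp add: exp_minus power2_eq_square field_simps)
      have "k * (2 * n - k - 1) + k * (k + 1) = 2 * n * k"
      proof -
        have "k * (2 * n - k - 1) + k * (k + 1) = k * ((2 * n - k - 1) + (k + 1))"
          by (rule distrib_left[symmetric])
        also have "(2 * n - k - 1) + (k + 1) = 2 * n" using elim by simp
        finally show ?thesis by simp
      qed
      then have "(1 - p n) ^ (k * (2 * n - k - 1)) * (1 - p n) ^ (k * (k + 1)) = ((1 - p n) ^ (2 * n)) ^ k"
        by (metis power_add power_mult)
      then have pw: "(1 - p n) ^ (k * (2 * n - k - 1)) = ((1 - p n) ^ (2 * n)) ^ k / (1 - p n) ^ (k * (k + 1))"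
        using q by (simp add: eq_divide_eq)
      have "measure_pmf.expectation (random_Knn n (p n)) (\<lambda>E. real (card (isolated_edges E) choose k)) =
          real ((n choose k)\<^sup>2 * fact k) * (p n ^ k * (1 - p n) ^ (k * (2 * n - k - 1)))"
        using p01 by (intro expectation_isolated_edges_choose) auto
      also have "\<dots> = ?f n ^ 2 / fact k * (real n ^ 2 * p n * (1 - p n) ^ (2 * n)) ^ k / (1 - p n) ^ (k * (k + 1))"
      proof -
        have "(real n ^ k)\<^sup>2 = (real n ^ 2) ^ k" by (simp add: power_mult[symmetric] mult.commute)
        moreover have "(real n ^ 2) ^ k \<noteq> 0" using n0 by simp
        ultimately show ?thesis
          unfolding pw power_mult_distrib power_divide of_nat_mult of_nat_power of_nat_fact
          by (simp add: field_simps power2_eq_square)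
      qed
      finally show ?case unfolding mr by simp
    qed
  qed
qed

text \<open>
  Interchange of limits for the truncation order \<open>m\<close> of the Bonferroni sums and \<open>n\<close>.
\<close>

lemma tendsto_of_approximations:
  fixes P :: "nat \<Rightarrow> real"
  assumes approx: "\<And>m n. m \<ge> m0 \<Longrightarrow> \<bar>P n - S m n\<bar> \<le> B m n"
    and S: "\<And>m. S m \<longlonglongrightarrow> S' m" and B: "\<And>m. B m \<longlonglongrightarrow> B' m"
    and S': "S' \<longlonglongrightarrow> L" and B': "B' \<longlonglongrightarrow> 0"
  shows "P \<longlonglongrightarrow> L"
proof (rule tendstoI)
  fix e :: real assume e: "e > 0"
  have "eventually (\<lambda>m. m \<ge> m0 \<and> \<bar>S' m - L\<bar> < e / 4 \<and> B' m < e / 4) sequentially"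
    using tendstoD[OF S', of "e / 4"] order_tendstoD(2)[OF B', of "e / 4"] e
    by (intro eventually_conj eventually_ge_at_top) (auto simp: dist_real_def)
  then obtain m where m: "m \<ge> m0" "\<bar>S' m - L\<bar> < e / 4" "B' m < e / 4"
    by (auto simp: eventually_sequentially)
  have "eventually (\<lambda>n. \<bar>S m n - S' m\<bar> < e / 4) sequentially"
    using tendstoD[OF S[of m], of "e / 4"] e by (simp add: dist_real_def)
  moreover have "eventually (\<lambda>n. B m n < e / 4) sequentially"
    using order_tendstoD(2)[OF B m(3)] .
  ultimately show "eventually (\<lambda>n. dist (P n) L < e) sequentially"
  proof eventually_elim
    case (elim n)
    have "\<bar>P n - L\<bar> \<le> \<bar>P n - S m n\<bar> + \<bar>S m n - S' m\<bar> + \<bar>S' m - L\<bar>" by linarith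
    then show ?case unfolding dist_real_def using elim approx[OF m(1), of n] m(2) e by linarith
  qed
qed

text \<open>
  The probability that a Poisson variable of mean \<open>l\<close> is at most one, as the limit of its Bonferroni sums.
\<close>

lemma poisson_at_most_one_series:
  fixes l :: real
  shows "(\<lambda>m. \<Sum>k\<le>m. (- 1) ^ k * (1 - real k) * (l ^ k / fact k)) \<longlonglongrightarrow> (1 + l) * exp (- l)"
    and "(\<lambda>m. real (m + 1) * (l ^ m / fact m)) \<longlonglongrightarrow> 0"
proof -
  have e: "(\<lambda>k. (- l) ^ k / fact k) sums exp (- l)"
    using exp_converges[of "- l"] by (simp add: divide_inverse mult.commute)
  have eq: "(- 1) ^ k * l ^ k = (- l) ^ k" for k by (simp add: power_mult_distrib[symmetric])
  have "(\<lambda>k. real (Suc k) * ((- l) ^ Suc k / fact (Suc k))) sums (- l * exp (- l))"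
  proof -
    have "(\<lambda>k. real (Suc k) * ((- l) ^ Suc k / fact (Suc k))) = (\<lambda>k. - l * ((- l) ^ k / fact k))"
      by (rule ext) (simp add: fact_Suc field_simps del: of_nat_Suc)
    then show ?thesis using sums_mult[OF e, of "- l"] by simp
  qed
  then have k: "(\<lambda>k. real k * ((- l) ^ k / fact k)) sums (- l * exp (- l))"
    by (subst (asm) sums_Suc_iff) simp
  have "(\<lambda>k. (- l) ^ k / fact k - real k * ((- l) ^ k / fact k)) sums (exp (- l) - - l * exp (- l))"
    by (rule sums_diff[OF e k])
  then have "(\<lambda>k. (- 1) ^ k * (1 - real k) * (l ^ k / fact k)) sums ((1 + l) * exp (- l))"
    by (simp add: eq[symmetric] algebra_simps diff_divide_distrib)
  then show "(\<lambda>m. \<Sum>k\<le>m. (- 1) ^ k * (1 - real k) * (l ^ k / fact k)) \<longlonglongrightarrow> (1 + l) * exp (- l)"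
    by (simp add: sums_def_le)
  have "(\<lambda>k. (- l) ^ k / fact k + real k * ((- l) ^ k / fact k)) \<longlonglongrightarrow> 0"
    using sums_summable[OF sums_add[OF e k]] by (rule summable_LIMSEQ_zero)
  then have "(\<lambda>k. \<bar>(- l) ^ k / fact k + real k * ((- l) ^ k / fact k)\<bar>) \<longlonglongrightarrow> 0"
    by (rule tendsto_rabs_zero)
  moreover have "\<bar>(- l) ^ k / fact k + real k * ((- l) ^ k / fact k)\<bar> = \<bar>real (k + 1) * (l ^ k / fact k)\<bar>" for k
  proof -
    have "(- l) ^ k / fact k + real k * ((- l) ^ k / fact k) = (- 1) ^ k * (real (k + 1) * (l ^ k / fact k))"
      unfolding eq[symmetric] by (simp add: algebra_simps add_divide_distrib)
    then show ?thesis by (simp add: abs_mult power_abs)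
  qed
  ultimately show "(\<lambda>m. real (m + 1) * (l ^ m / fact m)) \<longlonglongrightarrow> 0"
    by (simp only: tendsto_rabs_zero_iff)
qed

lemma prob_at_most_one_isolated_edge_tendsto:
  fixes p :: "nat \<Rightarrow> real"
  assumes p: "\<And>n. n \<ge> 2 \<Longrightarrow> 0 \<le> p n \<and> p n \<le> 1 / 2"
    and p0: "p \<longlonglongrightarrow> 0" and p2: "(\<lambda>n. real n * (p n)\<^sup>2) \<longlonglongrightarrow> 0"
    and \<lambda>: "(\<lambda>n. real n * (p n * n) * exp (- (2 * (p n * n)))) \<longlonglongrightarrow> l"
  shows "(\<lambda>n. measure_pmf.prob (random_Knn n (p n)) {E. card (isolated_edges E) \<le> 1}) \<longlonglongrightarrow>
    (1 + l) * exp (- l)"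
proof -
  let ?E = "\<lambda>k n. measure_pmf.expectation (random_Knn n (p n)) (\<lambda>E. real (card (isolated_edges E) choose k))"
  note E = expectation_isolated_edges_choose_tendsto[OF p p0 p2 \<lambda>]
  show ?thesis
  proof (rule tendsto_of_approximations)
    show "\<bar>measure_pmf.prob (random_Knn n (p n)) {E. card (isolated_edges E) \<le> 1} -
        (\<Sum>k\<le>m. (- 1) ^ k * (1 - real k) * ?E k n)\<bar> \<le> real (m + 1) * ?E m n" if "m \<ge> 2" for m n
      using that by (intro prob_at_most_one_bonferroni finite_subset[OF set_pmf_random_subgraph]) auto
    show "(\<lambda>n. \<Sum>k\<le>m. (- 1) ^ k * (1 - real k) * ?E k n) \<longlonglongrightarrow>
        (\<Sum>k\<le>m. (- 1) ^ k * (1 - real k) * (l ^ k / fact k))" for m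
      by (intro tendsto_intros E)
    show "(\<lambda>n. real (m + 1) * ?E m n) \<longlonglongrightarrow> real (m + 1) * (l ^ m / fact m)" for m
      by (intro tendsto_intros E)
  qed (fact poisson_at_most_one_series)+
qed

lemma prob_two_isolated_edges_le_expectation:
  assumes fin: "finite I" "finite J" and n: "card I = n" "card J = n" and p: "0 \<le> p" "p \<le> 1 / 2"
  shows "measure_pmf.prob (random_subgraph I J p) {E. \<not> card (isolated_edges E) \<le> 1} \<le>
    3 * (n * (p * n) * exp (- (2 * (p * n))))"
proof -
  let ?M = "random_subgraph I J p"
  have p1: "p \<le> 1" using p by simp
  have "measure_pmf.prob ?M {E. \<not> card (isolated_edges E) \<le> 1} =
      measure_pmf.expectation ?M (indicator {E. \<not> card (isolated_edges E) \<le> 1})" by simp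
  also have "\<dots> \<le> measure_pmf.expectation ?M (\<lambda>E. real (card (isolated_edges E) choose 1))"
    by (intro integral_mono random_subgraph_integrable fin) (simp add: indicator_def)
  also have "\<dots> = real n ^ 2 * p * (1 - p) ^ (2 * n - 2)"
    using expectation_isolated_edges_choose[OF fin n p(1) p1, of 1] by (simp add: mult.assoc numeral_2_eq_2)
  also have "\<dots> \<le> real n ^ 2 * p * (exp 1 * exp (- (2 * (p * n))))"
  proof (intro mult_left_mono)
    have "(1 - p) ^ (2 * n - 2) \<le> exp (- p) ^ (2 * n - 2)"
      using p exp_ge_add_one_self[of "- p"] by (intro power_mono) auto
    also have "\<dots> = exp (- (p * real (2 * n - 2)))"
      by (simp add: exp_of_nat_mult[symmetric] mult_ac)
    also have "\<dots> \<le> exp (1 + - (2 * (p * n)))"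
    proof -
      have "real (2 * n) \<le> real ((2 * n - 2) + 2)" by (intro of_nat_mono) simp
      then have "p * real (2 * n) \<le> p * (real (2 * n - 2) + 2)" using p by (intro mult_left_mono) auto
      then show ?thesis using p by (simp add: algebra_simps)
    qed
    also have "\<dots> = exp 1 * exp (- (2 * (p * n)))" by (rule exp_add)
    finally show "(1 - p) ^ (2 * n - 2) \<le> exp 1 * exp (- (2 * (p * n)))" .
  qed (use p in simp)
  also have "\<dots> = exp 1 * (n * (p * n) * exp (- (2 * (p * n))))" by (simp add: power2_eq_square)
  also have "\<dots> \<le> 3 * (n * (p * n) * exp (- (2 * (p * n))))"
    using p exp_le by (intro mult_right_mono) auto
  finally show ?thesis .
qed

text \<open>
  The parametrisation of \<open>p\<close> is chosen so that \<open>exp (2 p n) = n ln n exp c\<close>.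
\<close>

lemma isolated_edge_density:
  assumes n: "n \<ge> 3" and p: "p = 1 / (2 * real n) * (ln (real n) + ln (ln (real n)) + c)"
  shows "n * (p * n) * exp (- (2 * (p * n))) = p * n / ln n * exp (- c)"
proof -
  have n0: "real n > 0" using n by simp
  have l0: "ln (real n) > 0" using n by (intro ln_gt_zero) simp
  have "2 * (p * n) = ln n + ln (ln n) + c" using n0 by (simp add: p field_simps)
  then have "exp (- (2 * (p * n))) = exp (- ln n) * exp (- ln (ln n)) * exp (- c)"
    by (simp add: exp_add[symmetric])
  also have "\<dots> = exp (- c) / (n * ln n)" using n0 l0 by (simp add: exp_minus field_simps)
  finally show ?thesis using n0 l0 by (simp add: field_simps)
qed

lemma whp_reconstructible:
  fixes p c :: "nat \<Rightarrow> real"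
  assumes p_eq: "\<And>n. n \<ge> 2 \<Longrightarrow> p n = 1 / (2 * real n) * (ln (real n) + ln (ln (real n)) + c n)"
    and p_range: "\<And>n. n \<ge> 2 \<Longrightarrow> 0 \<le> p n \<and> p n \<le> 1 / 2"
    and c: "filterlim c at_top sequentially"
  shows "whp (\<lambda>n. random_Knn n (p n)) (\<lambda>n E. reconstructible {..<n} {..<n} E)"
proof -
  let ?x = "\<lambda>n. p n * real n"
  let ?P = "\<lambda>n. measure_pmf.prob (random_Knn n (p n))"
  have x2: "2 * ?x n = ln n + ln (ln n) + c n" if "n \<ge> 2" for n
    using that p_eq[OF that] by (simp add: field_simps)
  have c0: "eventually (\<lambda>n. 0 \<le> c n) sequentially" using c by (simp add: filterlim_at_top)
  have ll: "eventually (\<lambda>n. 0 \<le> ln (ln (real n))) sequentially" by real_asymp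
  have ll': "eventually (\<lambda>n. ln (ln (real n)) \<le> ln (real n)) sequentially" by real_asymp
  have l1: "eventually (\<lambda>n. 1 \<le> ln (real n)) sequentially" by real_asymp
  have lower: "eventually (\<lambda>n. ln (real n) / 2 \<le> ?x n) sequentially"
    using c0 ll eventually_ge_at_top[of 2]
  proof eventually_elim
    case (elim n)
    then show ?case using x2[OF elim(3)] by linarith
  qed
  note key = prob_not_reconstructible_few_isolated_edges_tendsto[OF p_range lower]
  have bound: "eventually (\<lambda>n. ?P n {E. \<not> card (isolated_edges E) \<le> 1} \<le> 3 * ((2 + c n) * exp (- c n))) sequentially"
    using c0 ll' l1 eventually_ge_at_top[of 3]
  proof eventually_elim
    case (elim n)
    have p01: "0 \<le> p n" "p n \<le> 1 / 2" using p_range elim by auto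
    have "?P n {E. \<not> card (isolated_edges E) \<le> 1} \<le> 3 * (n * (p n * n) * exp (- (2 * (p n * n))))"
      using p01 by (intro prob_two_isolated_edges_le_expectation) auto
    also have "\<dots> = 3 * (p n * n / ln n * exp (- c n))"
      using isolated_edge_density[OF elim(4) p_eq] elim by simp
    also have "\<dots> \<le> 3 * ((2 + c n) * exp (- c n))"
    proof (intro mult_left_mono mult_right_mono)
      have "c n * 1 \<le> c n * ln n" using elim by (intro mult_left_mono) auto
      moreover have "(2 + c n) * ln n = 2 * ln n + c n * ln n" by (rule distrib_right)
      moreover have "2 * ?x n = ln n + ln (ln n) + c n" using elim by (intro x2) simp
      ultimately have "?x n \<le> (2 + c n) * ln n" using elim by linarith
      then show "p n * n / ln n \<le> 2 + c n" using elim by (simp add: divide_le_eq)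
    qed auto
    finally show ?case .
  qed
  have "((\<lambda>t. 3 * ((2 + t) * exp (- t))) \<longlongrightarrow> (0::real)) at_top" by real_asymp
  then have lim: "(\<lambda>n. 3 * ((2 + c n) * exp (- c n))) \<longlonglongrightarrow> 0" using c by (rule filterlim_compose)
  have two: "(\<lambda>n. ?P n {E. \<not> card (isolated_edges E) \<le> 1}) \<longlonglongrightarrow> 0"
    by (rule tendsto_sandwich[OF _ bound tendsto_const lim]) simp
  have "(\<lambda>n. ?P n {E. \<not> reconstructible {..<n} {..<n} E}) \<longlonglongrightarrow> 0"
  proof (rule tendsto_sandwich[OF _ _ tendsto_const])
    show "(\<lambda>n. ?P n {E. \<not> reconstructible {..<n} {..<n} E \<and> card (isolated_edges E) \<le> 1} +
        ?P n {E. \<not> card (isolated_edges E) \<le> 1}) \<longlonglongrightarrow> 0"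
      using tendsto_add[OF key two] by simp
    show "eventually (\<lambda>n. ?P n {E. \<not> reconstructible {..<n} {..<n} E} \<le>
        ?P n {E. \<not> reconstructible {..<n} {..<n} E \<and> card (isolated_edges E) \<le> 1} +
        ?P n {E. \<not> card (isolated_edges E) \<le> 1}) sequentially"
    proof (rule always_eventually, rule allI)
      fix n
      have "?P n {E. \<not> reconstructible {..<n} {..<n} E} \<le>
          ?P n ({E. \<not> reconstructible {..<n} {..<n} E \<and> card (isolated_edges E) \<le> 1} \<union>
            {E. \<not> card (isolated_edges E) \<le> 1})"
        by (intro measure_pmf.finite_measure_mono) auto
      also have "\<dots> \<le> ?P n {E. \<not> reconstructible {..<n} {..<n} E \<and> card (isolated_edges E) \<le> 1} +
            ?P n {E. \<not> card (isolated_edges E) \<le> 1}"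
        by (intro measure_Un_le) auto
      finally show "?P n {E. \<not> reconstructible {..<n} {..<n} E} \<le>
          ?P n {E. \<not> reconstructible {..<n} {..<n} E \<and> card (isolated_edges E) \<le> 1} +
            ?P n {E. \<not> card (isolated_edges E) \<le> 1}" .
    qed
  qed simp
  then have "(\<lambda>n. 1 - ?P n {E. \<not> reconstructible {..<n} {..<n} E}) \<longlonglongrightarrow> 1 - 0"
    by (intro tendsto_intros)
  then show ?thesis by (simp add: whp_def prob_Collect_not)
qed

lemma isolated_edges_mean_lower_bound:
  assumes n: "n \<ge> 3" and p: "0 \<le> p" "p \<le> 1 / 2" and np2: "n * p\<^sup>2 \<le> 1"
  shows "exp (- 4) * (n * (p * n) * exp (- (2 * (p * n)))) \<le> real n ^ 2 * p * (1 - p) ^ (2 * n - 2)"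
proof -
  have "\<bar>ln (1 + - p) - (- p)\<bar> \<le> 2 * (- p)\<^sup>2"
    using p by (intro abs_ln_one_plus_x_minus_x_bound) auto
  then have "- p - 2 * p\<^sup>2 \<le> ln (1 - p)" by (simp add: abs_le_iff)
  then have "real (2 * n) * (- p - 2 * p\<^sup>2) \<le> real (2 * n) * ln (1 - p)" by (intro mult_left_mono) auto
  then have "- 4 + - (2 * (p * n)) \<le> real (2 * n) * ln (1 - p)" using np2 by (simp add: algebra_simps)
  then have "exp (- 4 + - (2 * (p * n))) \<le> exp (real (2 * n) * ln (1 - p))" by (simp only: exp_le_cancel_iff)
  also have "\<dots> = (1 - p) ^ (2 * n)" unfolding exp_of_nat_mult using p by simp
  also have "\<dots> \<le> (1 - p) ^ (2 * n - 2)" using p by (intro power_decreasing) auto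
  finally have "real n ^ 2 * p * exp (- 4 + - (2 * (p * n))) \<le> real n ^ 2 * p * (1 - p) ^ (2 * n - 2)"
    using p by (intro mult_left_mono) auto
  then show ?thesis by (simp only: exp_add power2_eq_square mult_ac)
qed

text \<open>
  Nothing keeps \<open>p\<close> away from \<open>0\<close> here.  For \<open>p n \<le> n\<^bsup>- 2/3\<^esup>\<close> it is unlikely that two edges meet.  Otherwise the mean number of
  isolated edges tends to infinity: it is at least of the order \<open>exp (- c)\<close> when \<open>p n \<ge> (ln n) / 8\<close>, and of
  the order \<open>n\<^bsup>1 - 2/3 - 1/4\<^esup> = n\<^bsup>1/12\<^esup>\<close> when \<open>p n\<close> is smaller.
\<close>

lemma whp_not_reconstructible:
  fixes p c :: "nat \<Rightarrow> real"
  assumes p_eq: "\<And>n. n \<ge> 2 \<Longrightarrow> p n = 1 / (2 * real n) * (ln (real n) + ln (ln (real n)) + c n)"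
    and p_range: "\<And>n. n \<ge> 2 \<Longrightarrow> 0 \<le> p n \<and> p n \<le> 1 / 2"
    and c: "filterlim c at_bot sequentially"
  shows "whp (\<lambda>n. random_Knn n (p n)) (\<lambda>n E. card E < 2 \<or> \<not> reconstructible {..<n} {..<n} E)"
proof -
  let ?x = "\<lambda>n. p n * real n"
  let ?P = "\<lambda>n. measure_pmf.prob (random_Knn n (p n))"
  have x2: "2 * ?x n = ln n + ln (ln n) + c n" if "n \<ge> 2" for n
    using that p_eq[OF that] by (simp add: field_simps)
  define d where "d n = 4 * exp 4 * (8 * exp (c n) + real n powr (- 1 / 12))" for n :: nat
  define b where "b n = 2 * real n powr (- 1 / 3) + d n + 32 * (ln n / n)" for n :: nat
  have "((\<lambda>t. exp t) \<longlongrightarrow> (0::real)) at_bot" by (rule exp_at_bot)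
  then have ec: "(\<lambda>n. exp (c n)) \<longlonglongrightarrow> 0" using c by (rule filterlim_compose)
  have pw: "(\<lambda>n. real n powr (- 1 / 12)) \<longlonglongrightarrow> 0" by real_asymp
  have "d \<longlonglongrightarrow> 4 * exp 4 * (8 * 0 + 0)" unfolding d_def by (intro tendsto_intros ec pw)
  then have d: "d \<longlonglongrightarrow> 0" by simp
  have pw3: "(\<lambda>n. 2 * real n powr (- 1 / 3)) \<longlonglongrightarrow> 0" by real_asymp
  have ln0: "(\<lambda>n. 32 * (ln (real n) / real n)) \<longlonglongrightarrow> 0" by real_asymp
  have b: "b \<longlonglongrightarrow> 0" unfolding b_def using tendsto_add[OF tendsto_add[OF pw3 d] ln0] by simp
  have ev: "eventually (\<lambda>n. c n \<le> 0) sequentially" using c by (simp add: filterlim_at_bot)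
  have ev2: "eventually (\<lambda>n. d n < 2) sequentially" using d by (rule order_tendstoD) simp
  have ev3: "eventually (\<lambda>n. ln (ln (real n)) \<le> ln (real n)) sequentially" by real_asymp
  have ev4: "eventually (\<lambda>n. (ln (real n))\<^sup>2 \<le> real n) sequentially" by real_asymp
  have bound: "eventually (\<lambda>n. ?P n {E. 2 \<le> card E \<and> card (isolated_edges E) \<le> 1} \<le> b n) sequentially"
    using ev ev2 ev3 ev4 eventually_ge_at_top[of 3]
  proof eventually_elim
    case (elim n)
    have p01: "0 \<le> p n" "p n \<le> 1 / 2" using p_range elim by auto
    have n0: "real n > 0" "real n \<ge> 1" using elim by auto
    have l0: "ln (real n) > 0" using elim by (intro ln_gt_zero) simp
    have d0: "d n > 0" unfolding d_def by (simp add: add_pos_nonneg)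
    have "n \<ge> 2" using elim by simp
    from x2[OF this] have xl: "?x n \<le> ln n" using elim by linarith
    have pl: "p n \<le> ln n / n" using xl n0 by (simp add: le_divide_eq)
    show ?case
    proof (cases "?x n \<le> real n powr (- 2 / 3)")
      case True
      have "?P n {E. 2 \<le> card E \<and> card (isolated_edges E) \<le> 1} \<le> 2 * real n ^ 3 * (p n)\<^sup>2"
        using p01 by (intro prob_two_edges_not_two_isolated_le) auto
      also have "\<dots> = 2 * real n * (?x n)\<^sup>2" by (simp add: power2_eq_square power3_eq_cube)
      also have "\<dots> \<le> 2 * real n * (real n powr (- 2 / 3))\<^sup>2"
        using True p01 by (intro mult_left_mono power_mono) auto
      also have "\<dots> = 2 * (real n powr 1 * (real n powr (- 2 / 3) * real n powr (- 2 / 3)))"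
        using n0 by (simp add: power2_eq_square)
      also have "\<dots> = 2 * real n powr (- 1 / 3)" by (simp only: powr_add[symmetric]) simp
      also have "\<dots> \<le> b n" using d0 l0 n0 by (simp add: b_def)
      finally show ?thesis .
    next
      case False
      define w where "w = n * (p n * n) * exp (- (2 * (p n * n)))"
      define \<mu> where "\<mu> = real n ^ 2 * p n * (1 - p n) ^ (2 * n - 2)"
      have x0: "?x n > 0" using False powr_gt_zero[of "real n" "- 2 / 3"] n0 by linarith
      have w0: "w > 0" unfolding w_def using x0 n0 by simp
      have w: "1 / w \<le> 8 * exp (c n) + real n powr (- 1 / 12)"
      proof (cases "?x n \<ge> ln n / 8")
        case True
        have "w = p n * n / ln n * exp (- c n)"
          unfolding w_def using isolated_edge_density[OF elim(5) p_eq] elim by simp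
        also have "\<dots> \<ge> 1 / 8 * exp (- c n)"
          using True l0 by (intro mult_right_mono) (auto simp: field_simps)
        finally have "1 / w \<le> 1 / (1 / 8 * exp (- c n))" by (intro divide_left_mono) (auto intro: mult_pos_pos w0)
        also have "\<dots> = 8 * exp (c n)" by (simp add: exp_minus field_simps)
        finally show ?thesis using powr_ge_zero[of "real n" "- 1 / 12"] by linarith
      next
        case small: False
        have "real n powr (1 / 12) = real n powr 1 * (real n powr (- 2 / 3) * real n powr (- 1 / 4))"
          by (simp only: powr_add[symmetric]) simp
        also have "\<dots> \<le> real n powr 1 * (?x n * exp (- (2 * ?x n)))"
        proof (intro mult_left_mono mult_mono)
          show "real n powr (- 2 / 3) \<le> ?x n" using False by simp
          have "real n powr (- 1 / 4) = exp (- 1 / 4 * ln n)" using n0 by (simp add: powr_def)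
          also have "\<dots> \<le> exp (- (2 * ?x n))" unfolding exp_le_cancel_iff using small by simp
          finally show "real n powr (- 1 / 4) \<le> exp (- (2 * ?x n))" .
        qed (use x0 in auto)
        also have "\<dots> = w" using n0 by (simp add: w_def)
        finally have "1 / w \<le> 1 / real n powr (1 / 12)"
          using n0 by (intro divide_left_mono) (auto intro: mult_pos_pos w0)
        also have "\<dots> = real n powr (- 1 / 12)" by (simp add: powr_minus_divide)
        finally show ?thesis using exp_gt_zero[of "c n"] by linarith
      qed
      have "(?x n)\<^sup>2 \<le> (ln n)\<^sup>2" using xl x0 by (intro power_mono) auto
      then have "(?x n)\<^sup>2 \<le> real n" using elim by simp
      then have "real n * (real n * (p n)\<^sup>2) \<le> real n * 1" by (simp add: power2_eq_square mult_ac)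
      then have np2: "n * (p n)\<^sup>2 \<le> 1" using n0(1) by (rule mult_left_le_imp_le)
      have \<mu>w: "exp (- 4) * w \<le> \<mu>"
        unfolding w_def \<mu>_def using elim p01 np2 by (intro isolated_edges_mean_lower_bound) auto
      have \<mu>0: "\<mu> > 0" using \<mu>w w0 by (metis exp_gt_zero mult_pos_pos less_le_trans)
      have "4 / \<mu> \<le> 4 / (exp (- 4) * w)" using \<mu>w w0 \<mu>0 by (intro divide_left_mono) auto
      also have "\<dots> = 4 * exp 4 * (1 / w)" by (simp add: exp_minus field_simps)
      also have "\<dots> \<le> d n" unfolding d_def using w by (intro mult_left_mono) auto
      finally have 4: "4 / \<mu> \<le> d n" .
      then have "4 / \<mu> \<le> 2" using elim by simp
      then have \<mu>2: "\<mu> \<ge> 2" using \<mu>0 by (simp add: divide_le_eq)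
      have "?P n {E. 2 \<le> card E \<and> card (isolated_edges E) \<le> 1} \<le> ?P n {E. card (isolated_edges E) \<le> 1}"
        by (intro measure_pmf.finite_measure_mono) auto
      also have "\<dots> \<le> 4 / \<mu> + 32 * p n"
        using p01 \<mu>2 \<mu>_def by (intro prob_at_most_one_isolated_edge_le) auto
      also have "\<dots> \<le> d n + 32 * (ln n / n)" using 4 pl by simp
      also have "\<dots> \<le> b n" by (simp add: b_def)
      finally show ?thesis .
    qed
  qed
  have lim: "(\<lambda>n. ?P n {E. 2 \<le> card E \<and> card (isolated_edges E) \<le> 1}) \<longlonglongrightarrow> 0"
    by (rule tendsto_sandwich[OF _ bound tendsto_const b]) simp
  have "(\<lambda>n. ?P n {E. \<not> (card E < 2 \<or> \<not> reconstructible {..<n} {..<n} E)}) \<longlonglongrightarrow> 0"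
  proof (rule tendsto_sandwich[OF _ _ tendsto_const lim])
    show "eventually (\<lambda>n. ?P n {E. \<not> (card E < 2 \<or> \<not> reconstructible {..<n} {..<n} E)} \<le>
        ?P n {E. 2 \<le> card E \<and> card (isolated_edges E) \<le> 1}) sequentially"
    proof (rule always_eventually, rule allI, rule prob_random_subgraph_mono)
      fix n and E :: "(nat \<times> nat) set"
      assume E: "E \<subseteq> {..<n} \<times> {..<n}" and h: "\<not> (card E < 2 \<or> \<not> reconstructible {..<n} {..<n} E)"
      have "\<not> 2 \<le> card (isolated_edges E)"
        using not_reconstructible_if_two_isolated_edges[OF _ _ E] h by auto
      then show "2 \<le> card E \<and> card (isolated_edges E) \<le> 1" using h by auto
    qed
  qed simp
  then have "(\<lambda>n. 1 - ?P n {E. \<not> (card E < 2 \<or> \<not> reconstructible {..<n} {..<n} E)}) \<longlonglongrightarrow> 1 - 0"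
    by (intro tendsto_intros)
  then show ?thesis unfolding whp_def by (subst (asm) prob_Collect_not) simp
qed

text \<open>
  Reconstructible graphs have at most one isolated edge, and almost all graphs with at most one isolated
  edge are reconstructible.
\<close>

lemma prob_reconstructible_tendsto_critical_prob:
  fixes p c :: "nat \<Rightarrow> real"
  assumes p_eq: "\<And>n. n \<ge> 2 \<Longrightarrow> p n = 1 / (2 * real n) * (ln (real n) + ln (ln (real n)) + c n)"
    and p_range: "\<And>n. n \<ge> 2 \<Longrightarrow> 0 \<le> p n \<and> p n \<le> 1 / 2"
    and c: "c \<longlonglongrightarrow> \<gamma>"
  shows "(\<lambda>n. measure_pmf.prob (random_Knn n (p n)) {E. reconstructible {..<n} {..<n} E}) \<longlonglongrightarrow>
    critical_prob \<gamma>"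
proof -
  let ?x = "\<lambda>n. p n * real n"
  let ?P = "\<lambda>n. measure_pmf.prob (random_Knn n (p n))"
  have x2: "2 * ?x n = ln n + ln (ln n) + c n" if "n \<ge> 2" for n
    using that p_eq[OF that] by (simp add: field_simps)
  have ratio: "(\<lambda>n. ?x n / ln n) \<longlonglongrightarrow> 1 / 2"
  proof (rule Lim_transform_eventually)
    have i: "(\<lambda>n. 1 / ln (real n)) \<longlonglongrightarrow> 0" by real_asymp
    have "(\<lambda>n. (ln (real n) + ln (ln (real n))) / (2 * ln (real n))) \<longlonglongrightarrow> 1 / 2" by real_asymp
    from tendsto_add[OF this tendsto_mult[OF tendsto_mult[OF c i] tendsto_const[of "1 / 2"]]]
    show "(\<lambda>n. (ln (real n) + ln (ln (real n))) / (2 * ln (real n)) + c n * (1 / ln (real n)) * (1 / 2)) \<longlonglongrightarrow> 1 / 2"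
      by simp
    show "eventually (\<lambda>n. (ln (real n) + ln (ln (real n))) / (2 * ln (real n)) + c n * (1 / ln (real n)) * (1 / 2)
        = ?x n / ln n) sequentially"
      using eventually_ge_at_top[of 3]
    proof eventually_elim
      case (elim n)
      have l0: "ln (real n) > 0" using elim by (intro ln_gt_zero) simp
      have e: "?x n = (ln n + ln (ln n) + c n) / 2" using x2[of n] elim by simp
      show ?case unfolding e using l0 by (simp add: field_simps)
    qed
  qed
  have p0: "p \<longlonglongrightarrow> 0"
  proof (rule Lim_transform_eventually)
    have "(\<lambda>n. ln (real n) / n) \<longlonglongrightarrow> 0" by real_asymp
    from tendsto_mult[OF ratio this] show "(\<lambda>n. ?x n / ln n * (ln (real n) / n)) \<longlonglongrightarrow> 0" by simp
    show "eventually (\<lambda>n. ?x n / ln n * (ln (real n) / n) = p n) sequentially"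
      using eventually_ge_at_top[of 3]
    proof eventually_elim
      case (elim n)
      have "ln (real n) > 0" using elim by (intro ln_gt_zero) simp
      then show ?case using elim by simp
    qed
  qed
  have p2: "(\<lambda>n. real n * (p n)\<^sup>2) \<longlonglongrightarrow> 0"
  proof (rule Lim_transform_eventually)
    have "(\<lambda>n. (ln (real n))\<^sup>2 / n) \<longlonglongrightarrow> 0" by real_asymp
    from tendsto_mult[OF tendsto_power[OF ratio, of 2] this]
    show "(\<lambda>n. (?x n / ln n)\<^sup>2 * ((ln (real n))\<^sup>2 / n)) \<longlonglongrightarrow> 0" by simp
    show "eventually (\<lambda>n. (?x n / ln n)\<^sup>2 * ((ln (real n))\<^sup>2 / n) = real n * (p n)\<^sup>2) sequentially"
      using eventually_ge_at_top[of 3]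
    proof eventually_elim
      case (elim n)
      have "ln (real n) > 0" using elim by (intro ln_gt_zero) simp
      then show ?case using elim by (simp add: power2_eq_square)
    qed
  qed
  define l where "l = exp (- \<gamma>) / 2"
  have \<lambda>: "(\<lambda>n. real n * (p n * n) * exp (- (2 * (p n * n)))) \<longlonglongrightarrow> l"
  proof (rule Lim_transform_eventually)
    have "(\<lambda>n. ?x n / ln n * exp (- c n)) \<longlonglongrightarrow> 1 / 2 * exp (- \<gamma>)"
      by (intro tendsto_intros ratio c)
    then show "(\<lambda>n. ?x n / ln n * exp (- c n)) \<longlonglongrightarrow> l" by (simp add: l_def)
    show "eventually (\<lambda>n. ?x n / ln n * exp (- c n) = real n * (p n * n) * exp (- (2 * (p n * n)))) sequentially"
      using eventually_ge_at_top[of 3]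
      by eventually_elim (use isolated_edge_density p_eq in simp)
  qed
  have lower: "eventually (\<lambda>n. ln (real n) / 2 \<le> ?x n) sequentially"
  proof -
    have "filterlim (\<lambda>n. ln (ln (real n))) at_top sequentially" by real_asymp
    then have "filterlim (\<lambda>n. c n + ln (ln (real n))) at_top sequentially"
      using c by (rule filterlim_tendsto_add_at_top[rotated])
    then have "eventually (\<lambda>n. 0 \<le> c n + ln (ln (real n))) sequentially" by (simp add: filterlim_at_top)
    then show ?thesis using eventually_ge_at_top[of 2]
    proof eventually_elim
      case (elim n)
      then show ?case using x2[OF elim(2)] by linarith
    qed
  qed
  note key = prob_not_reconstructible_few_isolated_edges_tendsto[OF p_range lower]
  note iso = prob_at_most_one_isolated_edge_tendsto[OF p_range p0 p2 \<lambda>]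
  have eq: "?P n {E. card (isolated_edges E) \<le> 1} -
      ?P n {E. \<not> reconstructible {..<n} {..<n} E \<and> card (isolated_edges E) \<le> 1} =
      ?P n {E. reconstructible {..<n} {..<n} E}" for n
  proof -
    have r: "?P n {E. reconstructible {..<n} {..<n} E} =
        ?P n {E. reconstructible {..<n} {..<n} E \<and> card (isolated_edges E) \<le> 1}"
    proof (intro antisym prob_random_subgraph_mono)
      fix E :: "(nat \<times> nat) set"
      assume E: "E \<subseteq> {..<n} \<times> {..<n}" and h: "reconstructible {..<n} {..<n} E"
      have "\<not> 2 \<le> card (isolated_edges E)"
        using not_reconstructible_if_two_isolated_edges[OF _ _ E] h by auto
      then show "reconstructible {..<n} {..<n} E \<and> card (isolated_edges E) \<le> 1" using h by auto
    qed auto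
    have "{E. card (isolated_edges E) \<le> 1} =
        {E. reconstructible {..<n} {..<n} E \<and> card (isolated_edges E) \<le> 1} \<union>
        {E. \<not> reconstructible {..<n} {..<n} E \<and> card (isolated_edges E) \<le> 1}" by auto
    also have "?P n \<dots> = ?P n {E. reconstructible {..<n} {..<n} E \<and> card (isolated_edges E) \<le> 1} +
        ?P n {E. \<not> reconstructible {..<n} {..<n} E \<and> card (isolated_edges E) \<le> 1}"
      by (intro measure_pmf.finite_measure_Union) auto
    finally show ?thesis using r by simp
  qed
  have "(\<lambda>n. ?P n {E. reconstructible {..<n} {..<n} E}) \<longlonglongrightarrow> (1 + l) * exp (- l) - 0"
    using tendsto_diff[OF iso key] unfolding eq .
  then show ?thesis by (simp add: critical_prob_def l_def)
qed

lemma critical_prob_bounds: "0 < critical_prob \<gamma>" "critical_prob \<gamma> < 1"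
proof -
  define l where "l = exp (- \<gamma>) / 2"
  have l: "l > 0" by (simp add: l_def)
  have eq: "critical_prob \<gamma> = (1 + l) * exp (- l)" by (simp add: critical_prob_def l_def)
  show "0 < critical_prob \<gamma>" unfolding eq using l by simp
  have "1 + l = exp (ln (1 + l))" using l by simp
  also have "\<dots> < exp l" unfolding exp_less_cancel_iff using l by (rule ln_add_one_self_less_self)
  finally have "1 + l < exp l" .
  then have "(1 + l) * exp (- l) < exp l * exp (- l)" by (intro mult_strict_right_mono) auto
  also have "\<dots> = 1" by (simp add: exp_add[symmetric])
  finally show "critical_prob \<gamma> < 1" unfolding eq .
qed

theorem corollary3:
  fixes p c :: "nat \<Rightarrow> real"
  assumes p_eq: "\<And>n. n \<ge> 2 \<Longrightarrow> p n = 1 / (2 * real n) * (ln (real n) + ln (ln (real n)) + c n)"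
    and p_range: "\<And>n. n \<ge> 2 \<Longrightarrow> 0 \<le> p n \<and> p n \<le> 1 / 2"
  shows "(filterlim c at_top sequentially \<longrightarrow>
            whp (\<lambda>n. random_Knn n (p n)) (\<lambda>n E. reconstructible {..<n} {..<n} E)) \<and>
         (filterlim c at_bot sequentially \<longrightarrow>
            whp (\<lambda>n. random_Knn n (p n)) (\<lambda>n E. card E < 2 \<or> \<not> reconstructible {..<n} {..<n} E)) \<and>
         (\<forall>\<gamma>::real. c \<longlonglongrightarrow> \<gamma> \<longrightarrow>
            (\<lambda>n. measure_pmf.prob (random_Knn n (p n)) {E. reconstructible {..<n} {..<n} E})
              \<longlonglongrightarrow> critical_prob \<gamma> \<and>
            0 < critical_prob \<gamma> \<and> critical_prob \<gamma> < 1)"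
  using whp_reconstructible[OF p_eq p_range] whp_not_reconstructible[OF p_eq p_range]
    prob_reconstructible_tendsto_critical_prob[OF p_eq p_range] critical_prob_bounds
  by blast

end
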